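(* There exist constants $C_1>0$, $\epsilon_0>0$ depending only on $M$ and $G$ such that for any $k\in\mathbb{N}$ and $0<\epsilon\leq\epsilon_0$ there is a $G$-equivariant continuous map $F:M\to M$ satisfying: (i) $F$ is $G$-homotopic to the identity relative to the skeleton $\pi^{-1}\circ F_1(K(k)_{l-1})$ (i.e. homotopic through $G$-equivariant maps fixing the skeleton pointwise); (ii) $F(M\setminus B^G_{\epsilon3^{-k}}(\tilde c(k)))\subset\pi^{-1}\circ F_1(K(k)_{l-1})=\bigcup_{\tilde\sigma\in\widetilde K(k)_l}\tilde\sigma\setminus\mathring{\tilde\sigma}$, and $F(B^G_{\epsilon3^{-k}}(\tilde c(k)))\subset\bigcup_{\tilde\sigma\in\widetilde K(k)_l}\mathring{\tilde\sigma}$; (iii) the induced map $F'=\pi\circ F\circ\pi^{-1}:M/G\to M/G$ is Lipschitz continuous with $|D(F')|\leq C_1\epsilon^{-1}$.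
   Context: $(M,g_M)$ is an orientable connected closed Riemannian manifold of dimension $n+1$; $G$ is a compact Lie group acting on $M$ by isometries with cohomogeneity (codimension of a principal orbit) $l\geq3$. $\pi:M\to M/G$ is the projection; $M/G$ has the induced quotient metric. $G_p$ is the isotropy group of $p$. $I(m,k)$ is the cell complex on $I^m=[0,1]^m$ obtained by dividing each factor into $3^k$ equal intervals. Fixed once and for all (depending only on $M$, $G$) are an $l$-dimensional cubical subcomplex $K$ of $I^m$ for some $m$ and a bi-Lipschitz homeomorphism $F_1:K\to M/G$, obtained from a triangulation of $M/G$. $K(k)$ is the subdivision of $K$ by cells of $I(m,k)$ and $K(k)_q$ its $q$-cells ($K(k)_{l-1}$ also denotes the union of the $(l-1)$-cells). For $\sigma\in K(k)_l$ with center $p_\sigma$ and interior $\mathring\sigma$, put $\tilde\sigma=\pi^{-1}(F_1(\sigma))$, $\mathring{\tilde\sigma}=\pi^{-1}(F_1(\mathring\sigma))$, and let $G\cdot p_{\tilde\sigma}=\pi^{-1}(F_1(p_\sigma))$ be the center orbit. $\widetilde K(k)_l=\{\tilde\sigma:\sigma\in K(k)_l\}$ and $\tilde c(k)=\{G\cdot p_{\tilde\sigma}:\sigma\in K(k)_l\}$. $K,F_1$ are chosen so that for all $k$ and all $\tilde\sigma\in\widetilde K(k)_l$ every orbit in $\mathring{\tilde\sigma}$ is principal, and there is a subset $\Omega\subset\tilde\sigma$ such that $\pi|_\Omega:\Omega\to\pi(\tilde\sigma)$ is a bi-Lipschitz homeomorphism with $G_p\supset G_{(\pi|_\Omega)^{-1}(F_1(p_\sigma))}$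 for all $p\in\Omega$. $B^G_r(\tilde c(k))$ is the union of the open tubes of radius $r$ around the center orbits in $\tilde c(k)$. $|D(F')|$ denotes the local Lipschitz constant of $F'$. *)

theory Defs
  imports "HOL-Analysis.Analysis" "HOL-Algebra.Group_Action"
begin

section \<open>Smooth manifolds\<close>

fun Ck_open :: "nat \<Rightarrow> 'e::real_normed_vector set \<Rightarrow> ('e \<Rightarrow> 'f::real_normed_vector) \<Rightarrow> bool" where
  "Ck_open 0 N f \<longleftrightarrow> continuous_on N f"
| "Ck_open (Suc k) N f \<longleftrightarrow> (\<forall>x\<in>N. f differentiable (at x)) \<and>
     (\<forall>v. Ck_open k N (\<lambda>x. frechet_derivative f (at x) v))"

text \<open>Smoothness on an arbitrary set, by local smooth extensions. On an open set, or on a relatively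
  open subset of a linear subspace, this is smoothness in the usual sense.\<close>

definition smooth_on :: "'e::real_normed_vector set \<Rightarrow> ('e \<Rightarrow> 'f::real_normed_vector) \<Rightarrow> bool" where
  "smooth_on W f \<longleftrightarrow>
     (\<forall>x\<in>W. \<exists>N h. open N \<and> x \<in> N \<and> (\<forall>k. Ck_open k N h) \<and> (\<forall>y\<in>N \<inter> W. h y = f y))"

type_synonym ('a, 'e) chart = "'a set \<times> ('a \<Rightarrow> 'e)"

definition chart_inv :: "('a, 'e) chart \<Rightarrow> 'e \<Rightarrow> 'a" where
  "chart_inv c = inv_into (fst c) (snd c)"

text \<open>Charts take values in a linear subspace \<open>E\<close> of a Euclidean space, so that manifolds of
  dimension 0 (e.g. finite groups), where \<open>E = {0}\<close>, are included: every type of class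
  \<open>euclidean_space\<close> itself has positive dimension.\<close>

definition is_chart :: "'e::euclidean_space set \<Rightarrow> 'a topology \<Rightarrow> ('a, 'e) chart \<Rightarrow> bool" where
  "is_chart E X c \<longleftrightarrow> openin X (fst c) \<and> openin (top_of_set E) (snd c ` fst c) \<and>
     homeomorphic_map (subtopology X (fst c)) (top_of_set (snd c ` fst c)) (snd c)"

definition smooth_atlas ::
  "'e::euclidean_space set \<Rightarrow> 'a topology \<Rightarrow> ('a, 'e) chart set \<Rightarrow> bool" where
  "smooth_atlas E X A \<longleftrightarrow> subspace E \<and> (\<forall>c\<in>A. is_chart E X c) \<and> (\<Union>c\<in>A. fst c) = topspace X \<and>
     (\<forall>c\<in>A. \<forall>c'\<in>A. smooth_on (snd c ` (fst c \<inter> fst c')) (snd c' \<circ> chart_inv c))"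

definition smooth_manifold ::
  "'e::euclidean_space set \<Rightarrow> 'a topology \<Rightarrow> ('a, 'e) chart set \<Rightarrow> bool" where
  "smooth_manifold E X A \<longleftrightarrow> Hausdorff_space X \<and> second_countable X \<and> smooth_atlas E X A"

definition smooth_map :: "'a topology \<Rightarrow> ('a, 'e::euclidean_space) chart set \<Rightarrow>
    'b topology \<Rightarrow> ('b, 'f::euclidean_space) chart set \<Rightarrow> ('a \<Rightarrow> 'b) \<Rightarrow> bool" where
  "smooth_map X A Y B f \<longleftrightarrow> continuous_map X Y f \<and>
     (\<forall>c\<in>A. \<forall>c'\<in>B. smooth_on (snd c ` (fst c \<inter> f -` fst c')) (snd c' \<circ> f \<circ> chart_inv c))"

definition prod_atlas ::
  "('a, 'e) chart set \<Rightarrow> ('b, 'f) chart set \<Rightarrow> ('a \<times> 'b, 'e \<times> 'f) chart set" where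
  "prod_atlas A B = {(U \<times> V, map_prod \<phi> \<psi>) | U \<phi> V \<psi>. (U, \<phi>) \<in> A \<and> (V, \<psi>) \<in> B}"

definition orientable ::
  "'a topology \<Rightarrow> ('a, real ^ 'n) chart set \<Rightarrow> bool" where
  "orientable X A \<longleftrightarrow> (\<exists>B. smooth_atlas UNIV X B \<and> smooth_atlas UNIV X (A \<union> B) \<and>
     (\<forall>c\<in>B. \<forall>c'\<in>B. \<forall>p\<in>fst c \<inter> fst c'.
        0 < det (matrix (frechet_derivative (snd c' \<circ> chart_inv c) (at (snd c p))))))"

definition embedded_submanifold ::
  "'a topology \<Rightarrow> ('a, real ^ 'n) chart set \<Rightarrow> 'a set \<Rightarrow> nat \<Rightarrow> bool" where
  "embedded_submanifold X A N d \<longleftrightarrow>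
     (\<forall>p\<in>N. \<exists>c L. smooth_atlas UNIV X (insert c A) \<and> p \<in> fst c \<and> subspace L \<and> dim L = d \<and>
        snd c ` (fst c \<inter> N) = snd c ` fst c \<inter> L)"

section \<open>Riemannian manifolds\<close>

text \<open>A Riemannian metric is given by its local expressions: \<open>g c p\<close> is the inner product on the
  tangent space at \<open>p\<close>, which is identified with \<open>real ^ 'n\<close> by the chart \<open>c\<close>. Compatibility of these
  expressions under changes of charts is \<open>preserves_metric\<close> for the identity map.\<close>

type_synonym ('a, 'e) local_metric = "('a, 'e) chart \<Rightarrow> 'a \<Rightarrow> 'e \<Rightarrow> 'e \<Rightarrow> real"

definition preserves_metric :: "('a, 'e::euclidean_space) chart set \<Rightarrow> ('a, 'e) local_metric \<Rightarrow>
    ('a \<Rightarrow> 'a) \<Rightarrow> bool" where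
  "preserves_metric A g f \<longleftrightarrow>
     (\<forall>c\<in>A. \<forall>c'\<in>A. \<forall>p\<in>fst c \<inter> f -` fst c'.
        let D = frechet_derivative (snd c' \<circ> f \<circ> chart_inv c) (at (snd c p))
        in \<forall>v w. g c' (f p) (D v) (D w) = g c p v w)"

definition riemannian_metric ::
  "('a, 'e::euclidean_space) chart set \<Rightarrow> ('a, 'e) local_metric \<Rightarrow> bool" where
  "riemannian_metric A g \<longleftrightarrow>
     (\<forall>c\<in>A. \<forall>p\<in>fst c. bilinear (g c p) \<and> (\<forall>v w. g c p v w = g c p w v) \<and>
        (\<forall>v. v \<noteq> 0 \<longrightarrow> 0 < g c p v v)) \<and>
     (\<forall>c\<in>A. \<forall>v w. smooth_on (snd c ` fst c) (\<lambda>x. g c (chart_inv c x) v w)) \<and>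
     preserves_metric A g id"

definition piecewise_C1_curve ::
  "('a::topological_space, 'e::euclidean_space) chart set \<Rightarrow> (real \<Rightarrow> 'a) \<Rightarrow> bool" where
  "piecewise_C1_curve A \<gamma> \<longleftrightarrow> continuous_on {0..1} \<gamma> \<and>
     (\<exists>S. finite S \<and>
        (\<forall>c\<in>A. (snd c \<circ> \<gamma>) C1_differentiable_on ({t\<in>{0..1}. \<gamma> t \<in> fst c} - S)))"

text \<open>The norm of the velocity; it does not depend on the choice of the chart around \<open>\<gamma> t\<close>.\<close>

definition speed :: "('a, 'e::euclidean_space) chart set \<Rightarrow> ('a, 'e) local_metric \<Rightarrow>
    (real \<Rightarrow> 'a) \<Rightarrow> real \<Rightarrow> real" where
  "speed A g \<gamma> t = (let c = (SOME c. c \<in> A \<and> \<gamma> t \<in> fst c); v = vector_derivative (snd c \<circ> \<gamma>) (at t)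
     in sqrt (g c (\<gamma> t) v v))"

definition curve_length :: "('a, 'e::euclidean_space) chart set \<Rightarrow> ('a, 'e) local_metric \<Rightarrow>
    (real \<Rightarrow> 'a) \<Rightarrow> ennreal" where
  "curve_length A g \<gamma> = (\<integral>\<^sup>+ t\<in>{0..1}. ennreal (speed A g \<gamma> t) \<partial>lborel)"

definition riemannian_dist :: "('a::topological_space, 'e::euclidean_space) chart set \<Rightarrow>
    ('a, 'e) local_metric \<Rightarrow> 'a \<Rightarrow> 'a \<Rightarrow> ennreal" where
  "riemannian_dist A g p q =
     (INF \<gamma> \<in> {\<gamma>. piecewise_C1_curve A \<gamma> \<and> \<gamma> 0 = p \<and> \<gamma> 1 = q}. curve_length A g \<gamma>)"

text \<open>The underlying set is a whole type of class \<open>metric_space\<close> carrying the Riemannian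
  distance, and the manifold topology is the topology of this metric.\<close>

definition closed_connected_riemannian_manifold ::
  "('a::metric_space, real ^ 'n) chart set \<Rightarrow> ('a, real ^ 'n) local_metric \<Rightarrow> bool" where
  "closed_connected_riemannian_manifold A g \<longleftrightarrow>
     smooth_manifold UNIV (euclidean :: 'a topology) A \<and>
     compact (UNIV :: 'a set) \<and> connected (UNIV :: 'a set) \<and>
     riemannian_metric A g \<and> (\<forall>p q. ennreal (dist p q) = riemannian_dist A g p q)"

section \<open>Lie group actions\<close>

definition compact_lie_group :: "('g, 'x) monoid_scheme \<Rightarrow> 'e::euclidean_space set \<Rightarrow>
    'g topology \<Rightarrow> ('g, 'e) chart set \<Rightarrow> bool" where
  "compact_lie_group G E T B \<longleftrightarrow> group G \<and> topspace T = carrier G \<and>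
     smooth_manifold E T B \<and> compact_space T \<and>
     smooth_map (prod_topology T T) (prod_atlas B B) T B (\<lambda>(x, y). x \<otimes>\<^bsub>G\<^esub> y) \<and>
     smooth_map T B T B (\<lambda>x. inv\<^bsub>G\<^esub> x)"

definition smooth_isometric_action :: "('g, 'x) monoid_scheme \<Rightarrow> 'g topology \<Rightarrow>
    ('g, 'e::euclidean_space) chart set \<Rightarrow> ('a::topological_space, real ^ 'n) chart set \<Rightarrow>
    ('a, real ^ 'n) local_metric \<Rightarrow> ('g \<Rightarrow> 'a \<Rightarrow> 'a) \<Rightarrow> bool" where
  "smooth_isometric_action G T B A g act \<longleftrightarrow>
     group_action G UNIV act \<and>
     smooth_map (prod_topology T euclidean) (prod_atlas B A) euclidean A (\<lambda>(x, p). act x p) \<and>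
     (\<forall>x\<in>carrier G. preserves_metric A g (act x))"

text \<open>The quotient \<open>M/G\<close> is the set \<open>orbits G UNIV act\<close> of orbits, the projection is
  \<open>orbit G act\<close>, and the quotient metric is \<open>setdist\<close> on orbits.\<close>

definition principal_orbit :: "('g, 'x) monoid_scheme \<Rightarrow> ('g \<Rightarrow> 'a \<Rightarrow> 'a) \<Rightarrow> 'a set \<Rightarrow> bool" where
  "principal_orbit G act Q \<longleftrightarrow> Q \<in> orbits G UNIV act \<and>
     (\<forall>p\<in>Q. \<forall>q. \<exists>x\<in>carrier G.
        (\<lambda>h. x \<otimes>\<^bsub>G\<^esub> h \<otimes>\<^bsub>G\<^esub> inv\<^bsub>G\<^esub> x) ` stabilizer G act p \<subseteq> stabilizer G act q)"

definition has_cohomogeneity :: "('a::topological_space, real ^ 'n) chart set \<Rightarrow>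
    ('g, 'x) monoid_scheme \<Rightarrow> ('g \<Rightarrow> 'a \<Rightarrow> 'a) \<Rightarrow> nat \<Rightarrow> bool" where
  "has_cohomogeneity A G act l \<longleftrightarrow> (\<exists>Q. principal_orbit G act Q) \<and>
     (\<forall>Q. principal_orbit G act Q \<longrightarrow>
        (\<exists>d. embedded_submanifold euclidean A Q d \<and> d + l = CARD('n)))"

definition equivariant :: "('g, 'x) monoid_scheme \<Rightarrow> ('g \<Rightarrow> 'a \<Rightarrow> 'a) \<Rightarrow> ('a \<Rightarrow> 'a) \<Rightarrow> bool" where
  "equivariant G act F \<longleftrightarrow> (\<forall>x\<in>carrier G. \<forall>p. F (act x p) = act x (F p))"

text \<open>For equivariant \<open>F\<close> the image of the orbit of \<open>p\<close> is the orbit of \<open>F p\<close>.\<close>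

definition induced_map :: "('a \<Rightarrow> 'a) \<Rightarrow> 'a set \<Rightarrow> 'a set" where
  "induced_map F Q = F ` Q"

definition open_tubes :: "real \<Rightarrow> 'a::metric_space set set \<Rightarrow> 'a set" where
  "open_tubes r \<C> = (\<Union>Q\<in>\<C>. {p. infdist p Q < r})"

section \<open>Cubical complexes\<close>

text \<open>The \<open>q\<close>-cells of \<open>I(m,k)\<close>: the \<open>i\<close>-th factor of a cell is the interval
  \<open>[a i / 3^k, (a i + 1) / 3^k]\<close> if \<open>i \<in> J\<close> and the vertex \<open>a i / 3^k\<close> otherwise.\<close>

definition grid_cells :: "nat \<Rightarrow> nat \<Rightarrow> (real ^ 'm) set set" where
  "grid_cells k q = {cbox (\<chi> i. real (a i) / 3 ^ k) (\<chi> i. real (a i + of_bool (i \<in> J)) / 3 ^ k) | a J.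
     card J = q \<and> (\<forall>i. a i + of_bool (i \<in> J) \<le> 3 ^ k)}"

text \<open>A face of a cell of \<open>I(m,0)\<close> is a cell of \<open>I(m,0)\<close> contained in it. An \<open>l\<close>-dimensional complex
  is understood to be pure, as it is for complexes obtained by triangulating \<open>M/G\<close>.\<close>

definition cubical_subcomplex :: "nat \<Rightarrow> (real ^ 'm) set set \<Rightarrow> bool" where
  "cubical_subcomplex l K \<longleftrightarrow> K \<subseteq> (\<Union>q. grid_cells 0 q) \<and>
     (\<forall>\<sigma>\<in>K. \<forall>\<tau>\<in>(\<Union>q. grid_cells 0 q). \<tau> \<subseteq> \<sigma> \<longrightarrow> \<tau> \<in> K) \<and>
     (\<forall>\<sigma>\<in>K. \<exists>\<tau>\<in>K \<inter> grid_cells 0 l. \<sigma> \<subseteq> \<tau>)"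

definition subdiv_cells :: "(real ^ 'm) set set \<Rightarrow> nat \<Rightarrow> nat \<Rightarrow> (real ^ 'm) set set" where
  "subdiv_cells K k q = {\<sigma>\<in>grid_cells k q. \<exists>\<tau>\<in>K. \<sigma> \<subseteq> \<tau>}"

definition cell_center :: "(real ^ 'm) set \<Rightarrow> real ^ 'm" where
  "cell_center \<sigma> = midpoint (interval_lowerbound \<sigma>) (interval_upperbound \<sigma>)"

section \<open>Lipschitz maps\<close>

definition bilipschitz_homeo :: "'a set \<Rightarrow> ('a \<Rightarrow> 'a \<Rightarrow> real) \<Rightarrow> 'b set \<Rightarrow> ('b \<Rightarrow> 'b \<Rightarrow> real) \<Rightarrow>
    ('a \<Rightarrow> 'b) \<Rightarrow> bool" where
  "bilipschitz_homeo S d S' d' f \<longleftrightarrow> bij_betw f S S' \<and>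
     (\<exists>L>0. \<forall>x\<in>S. \<forall>y\<in>S. d' (f x) (f y) \<le> L * d x y \<and> d x y \<le> L * d' (f x) (f y))"

definition lipschitz_map ::
  "'a set \<Rightarrow> ('a \<Rightarrow> 'a \<Rightarrow> real) \<Rightarrow> ('b \<Rightarrow> 'b \<Rightarrow> real) \<Rightarrow> ('a \<Rightarrow> 'b) \<Rightarrow> bool" where
  "lipschitz_map S d d' f \<longleftrightarrow> (\<exists>L. \<forall>x\<in>S. \<forall>y\<in>S. d' (f x) (f y) \<le> L * d x y)"

text \<open>The limit, as \<open>r\<close> tends to 0, of the Lipschitz constant of \<open>f\<close> on the ball of radius \<open>r\<close>
  around \<open>x\<close>. It is bounded below by the pointwise constant
  \<open>limsup\<^bsub>y \<rightarrow> x\<^esub> d' (f y) (f x) / d y x\<close>.\<close>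

definition local_lipschitz_const :: "'a set \<Rightarrow> ('a \<Rightarrow> 'a \<Rightarrow> real) \<Rightarrow> ('b \<Rightarrow> 'b \<Rightarrow> real) \<Rightarrow>
    ('a \<Rightarrow> 'b) \<Rightarrow> 'a \<Rightarrow> ennreal" where
  "local_lipschitz_const S d d' f x =
     (INF r\<in>{0<..}. SUP (y, z)\<in>{(y, z). y \<in> S \<and> z \<in> S \<and> y \<noteq> z \<and> d x y < r \<and> d x z < r}.
        ennreal (d' (f y) (f z) / d y z))"

section \<open>Cubical structures adapted to the action\<close>

definition lift :: "('g, 'x) monoid_scheme \<Rightarrow> ('g \<Rightarrow> 'a \<Rightarrow> 'a) \<Rightarrow> ('k \<Rightarrow> 'a set) \<Rightarrow> 'k set \<Rightarrow> 'a set" where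
  "lift G act F1 S = orbit G act -` (F1 ` S)"

definition center_orbits ::
  "(real ^ 'm \<Rightarrow> 'a set) \<Rightarrow> (real ^ 'm) set set \<Rightarrow> nat \<Rightarrow> nat \<Rightarrow> 'a set set" where
  "center_orbits F1 K l k = {F1 (cell_center \<sigma>) | \<sigma>. \<sigma> \<in> subdiv_cells K k l}"

definition adapted_cubical_structure :: "('g, 'x) monoid_scheme \<Rightarrow>
    ('g \<Rightarrow> 'a::metric_space \<Rightarrow> 'a) \<Rightarrow> nat \<Rightarrow> (real ^ 'm) set set \<Rightarrow> (real ^ 'm \<Rightarrow> 'a set) \<Rightarrow> bool" where
  "adapted_cubical_structure G act l K F1 \<longleftrightarrow>
     cubical_subcomplex l K \<and>
     bilipschitz_homeo (\<Union>K) dist (orbits G UNIV act) setdist F1 \<and>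
     (\<forall>k. \<forall>\<sigma>\<in>subdiv_cells K k l.
        (\<forall>x\<in>rel_interior \<sigma>. principal_orbit G act (F1 x)) \<and>
        (\<exists>\<Omega>\<subseteq>lift G act F1 \<sigma>.
           bilipschitz_homeo \<Omega> dist (orbit G act ` lift G act F1 \<sigma>) setdist (orbit G act) \<and>
           (\<forall>p\<in>\<Omega>. stabilizer G act (inv_into \<Omega> (orbit G act) (F1 (cell_center \<sigma>)))
                     \<subseteq> stabilizer G act p)))"

end

theory Submission
  imports Defs
begin

text \<open>On a cell \<open>\<sigma>\<close> of \<open>K(k)\<^sub>l\<close> with center \<open>c\<close>, push every point \<open>x\<close> radially away from \<open>c\<close> so that its
  distance to \<open>c\<close> in the maximum norm, relative to that of the boundary, becomes
  \<open>min 1 (d (F\<^sub>1 x) (F\<^sub>1 c) / (\<epsilon> 3\<^sup>-\<^sup>k))\<close>. The tube around the center orbit then covers exactly the open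
  cell, everything else lands on the boundary, and the boundary is fixed once \<open>\<epsilon> \<le> 1 / (2 L)\<close>, where
  \<open>L\<close> is a bi-Lipschitz constant of \<open>F\<^sub>1\<close>. On each cell the Lipschitz constant is of order \<open>1 / \<epsilon>\<close>, and
  this passes to the whole complex: two points in cells that meet are joined through a point of
  the common face which is not farther from them than they are from each other, and disjoint cells
  are at least \<open>3\<^sup>-\<^sup>k\<close> apart.

  The map and its linear homotopy to the identity lift to \<open>M\<close> by \<open>g \<cdot> s(x) \<mapsto> g \<cdot> s(\<phi>(x))\<close>, where \<open>s\<close> is the
  section over \<open>\<sigma>\<close>. This is well defined since all isotropy groups along the section contain that of
  the center, with equality over the open cell: the orbits there are principal, and by recurrence
  of isometries of a compact space a conjugate of an isotropy group \<open>H\<close> inside \<open>H\<close> is \<open>H\<close>. Continuity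
  of the lift follows as \<open>G \<times> \<sigma>\<close> is a compact space that maps onto the preimage of \<open>\<sigma>\<close>.\<close>

section \<open>Isometric actions preserve the Riemannian distance\<close>

lemma Ck_open_1_frechet:
  assumes "\<forall>k. Ck_open k N f"
  shows "\<forall>x\<in>N. f differentiable (at x)" "continuous_on N (\<lambda>x. frechet_derivative f (at x) v)"
proof -
  have "Ck_open (Suc 0) N f" using assms by blast
  then show "\<forall>x\<in>N. f differentiable (at x)" "continuous_on N (\<lambda>x. frechet_derivative f (at x) v)"
    by simp_all
qed

lemma chart_inv_eq:
  assumes "inj_on (snd c) (fst c)" "p \<in> fst c"
  shows "chart_inv c (snd c p) = p"
  using assms by (simp add: chart_inv_def inv_into_f_f)

lemma is_chart_inj_on:
  assumes "is_chart E X c"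
  shows "inj_on (snd c) (fst c)"
proof -
  have "fst c \<subseteq> topspace X"
    using assms by (auto simp: is_chart_def dest: openin_subset)
  moreover have "inj_on (snd c) (topspace (subtopology X (fst c)))"
    using assms homeomorphic_map_def unfolding is_chart_def homeomorphic_eq_everything_map by blast
  ultimately show ?thesis by (simp add: Int_absorb1)
qed

lemma is_chart_continuous_on:
  assumes "is_chart E (euclidean :: 'a::topological_space topology) c"
  shows "continuous_on (fst c) (snd c)" "open (fst c)"
proof -
  have "continuous_map (top_of_set (fst c)) (top_of_set (snd c ` fst c)) (snd c)"
    using assms homeomorphic_imp_continuous_map by (metis is_chart_def)
  then show "continuous_on (fst c) (snd c)"
    by (simp add: continuous_map_in_subtopology)
  show "open (fst c)"
    using assms by (simp add: is_chart_def)
qed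

lemma is_chart_open_image:
  assumes "is_chart UNIV (euclidean :: 'a::topological_space topology) c"
    and "open U" "U \<subseteq> fst c"
  shows "open (snd c ` U)"
proof -
  have "homeomorphic_map (top_of_set (fst c)) (top_of_set (snd c ` fst c)) (snd c)"
    and op: "open (snd c ` fst c)"
    using assms by (auto simp: is_chart_def)
  then have "openin (top_of_set (snd c ` fst c)) (snd c ` U)"
    using assms homeomorphic_imp_open_map open_map_def
    by (metis open_openin openin_open_eq open_subset subtopology_UNIV)
  then show ?thesis using op openin_open_trans by blast
qed

text \<open>Functions that agree near a point have the same derivatives there, so the choice
  operator inside \<open>frechet_derivative\<close> picks the same map. The second equation
  therefore holds whether or not a derivative exists.\<close>

lemma frechet_derivative_cong:
  assumes "open N" "z \<in> N" "\<And>y. y \<in> N \<Longrightarrow> f y = h y"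
  shows "f differentiable (at z) \<longleftrightarrow> h differentiable (at z)"
    and "frechet_derivative f (at z) = frechet_derivative h (at z)"
proof -
  have *: "(f has_derivative D) (at z) \<longleftrightarrow> (h has_derivative D) (at z)" for D
    using assms by (metis has_derivative_transform_within_open)
  then show "f differentiable (at z) \<longleftrightarrow> h differentiable (at z)"
    by (simp add: differentiable_def)
  show "frechet_derivative f (at z) = frechet_derivative h (at z)"
    using * by (simp add: frechet_derivative_def)
qed

text \<open>The set \<open>W\<close> may fail to be open in the product, since group charts take
  values in a subspace, so \<open>f\<close> itself need not have a full derivative. Its local
  extension \<open>h\<close> has one on an open set. Freezing the first coordinate leaves a function
  on an open part of \<open>V\<close> whose derivative is that of \<open>h\<close> in the directions
  \<open>(0, v)\<close>.\<close>

lemma smooth_on_slice: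
  fixes f :: "'e::euclidean_space \<times> 'f::euclidean_space \<Rightarrow> 'h::euclidean_space"
  assumes "smooth_on W f" "(e, z) \<in> W" "open V" "z \<in> V" "\<And>y. y \<in> V \<Longrightarrow> (e, y) \<in> W"
  obtains N where "open N" "z \<in> N" "N \<subseteq> V" "\<And>y. y \<in> N \<Longrightarrow> (\<lambda>y. f (e, y)) differentiable (at y)"
    "\<And>v. continuous_on N (\<lambda>y. frechet_derivative (\<lambda>y. f (e, y)) (at y) v)"
proof -
  obtain M h where M: "open M" "(e, z) \<in> M" and Ck: "\<forall>k. Ck_open k M h"
      and eq: "\<forall>y\<in>M \<inter> W. h y = f y"
    using assms(1,2) unfolding smooth_on_def by metis
  define N where "N = V \<inter> Pair e -` M"
  have cont: "continuous_on A (Pair e)" for A :: "'f set"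
    by (intro continuous_intros)
  have N: "open N" "z \<in> N" "N \<subseteq> V"
    using M assms cont by (auto simp: N_def intro!: open_Int open_vimage)
  have der: "((\<lambda>y. h (e, y)) has_derivative (\<lambda>v. frechet_derivative h (at (e, y)) (0, v))) (at y)"
    if "y \<in> N" for y
  proof -
    have "(h has_derivative frechet_derivative h (at (e, y))) (at (e, y))"
      using Ck_open_1_frechet(1)[OF Ck] that frechet_derivative_works by (auto simp: N_def)
    moreover have "((\<lambda>y. (e, y)) has_derivative (\<lambda>v. (0, v))) (at y)"
      by (auto intro!: derivative_eq_intros)
    ultimately show ?thesis
      using diff_chain_at[of "Pair e" "\<lambda>v. (0, v)" y h] by (simp add: o_def)
  qed
  have eqN: "h (e, y) = f (e, y)" if "y \<in> N" for y
    using that assms eq by (auto simp: N_def)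
  have fder: "((\<lambda>y. f (e, y)) has_derivative (\<lambda>v. frechet_derivative h (at (e, y)) (0, v))) (at y)"
    if "y \<in> N" for y
    using der[OF that] N that eqN by (metis (no_types, lifting) has_derivative_transform_within_open)
  have "frechet_derivative (\<lambda>y. f (e, y)) (at y) v = frechet_derivative h (at (e, y)) (0, v)"
    if "y \<in> N" for y v
    using frechet_derivative_at[OF fder[OF that]] by metis
  moreover have "continuous_on N (\<lambda>y. frechet_derivative h (at (e, y)) (0, v))" for v
    using continuous_on_compose2[OF Ck_open_1_frechet(2)[OF Ck, of "(0, v)"] cont[of N]]
    by (auto simp: N_def)
  ultimately have "continuous_on N (\<lambda>y. frechet_derivative (\<lambda>y. f (e, y)) (at y) v)" for v
    by (metis (no_types, lifting) continuous_on_cong)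
  then show thesis
    using that[of N] N fder by (meson differentiable_def)
qed

section \<open>Curves and lengths under self-maps that are continuously differentiable in
  charts\<close>

locale smooth_self_map =
  fixes A :: "('a::metric_space, real ^ 'n) chart set" and \<phi> :: "'a \<Rightarrow> 'a"
  assumes charts: "\<And>c. c \<in> A \<Longrightarrow> is_chart UNIV euclidean c"
    and cover: "(\<Union>c\<in>A. fst c) = UNIV"
    and continuous: "continuous_on UNIV \<phi>"
    and C1_local: "\<And>c c' p. c \<in> A \<Longrightarrow> c' \<in> A \<Longrightarrow> p \<in> fst c \<Longrightarrow> \<phi> p \<in> fst c' \<Longrightarrow>
      \<exists>N. open N \<and> snd c p \<in> N \<and> N \<subseteq> snd c ` (fst c \<inter> \<phi> -` fst c') \<and>
        (\<forall>z\<in>N. (snd c' \<circ> \<phi> \<circ> chart_inv c) differentiable (at z)) \<and>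
        (\<forall>v. continuous_on N (\<lambda>z. frechet_derivative (snd c' \<circ> \<phi> \<circ> chart_inv c) (at z) v))"
begin

text \<open>Chain rule. Continuity on the open set \<open>U\<close> keeps the curve inside the
  domain of \<open>c\<close> near \<open>t\<close>, where \<open>chart_inv c\<close> cancels
  \<open>snd c\<close> and the coordinate expressions compose.\<close>

lemma vector_derivative_chart_comp:
  assumes "c \<in> A" "c' \<in> A" "\<gamma> t \<in> fst c" "\<phi> (\<gamma> t) \<in> fst c'" "open U" "t \<in> U" "continuous_on U \<gamma>"
    and diff: "(snd c \<circ> \<gamma>) differentiable (at t)"
  shows "((snd c' \<circ> (\<phi> \<circ> \<gamma>)) has_vector_derivative
    frechet_derivative (snd c' \<circ> \<phi> \<circ> chart_inv c) (at (snd c (\<gamma> t)))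
      (vector_derivative (snd c \<circ> \<gamma>) (at t))) (at t)"
proof -
  let ?\<psi> = "snd c' \<circ> \<phi> \<circ> chart_inv c"
  have "?\<psi> differentiable (at (snd c (\<gamma> t)))"
    using C1_local[OF assms(1-4)] by blast
  then have "(?\<psi> has_derivative frechet_derivative ?\<psi> (at ((snd c \<circ> \<gamma>) t))) (at ((snd c \<circ> \<gamma>) t))"
    by (simp add: frechet_derivative_works)
  moreover have "((snd c \<circ> \<gamma>) has_vector_derivative vector_derivative (snd c \<circ> \<gamma>) (at t)) (at t)"
    using diff by (simp add: vector_derivative_works)
  ultimately have *: "((?\<psi> \<circ> (snd c \<circ> \<gamma>)) has_vector_derivative
      frechet_derivative ?\<psi> (at (snd c (\<gamma> t))) (vector_derivative (snd c \<circ> \<gamma>) (at t))) (at t)"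
    using vector_derivative_diff_chain_within[of "snd c \<circ> \<gamma>" _ t UNIV ?\<psi>]
    by (simp add: has_derivative_at_withinI)
  define V where "V = U \<inter> \<gamma> -` fst c"
  have "open V" "t \<in> V"
    using assms continuous_open_preimage[of U \<gamma> "fst c"] is_chart_continuous_on(2)[OF charts]
    by (auto simp: V_def)
  moreover have "(?\<psi> \<circ> (snd c \<circ> \<gamma>)) s = (snd c' \<circ> (\<phi> \<circ> \<gamma>)) s" if "s \<in> V" for s
    using that chart_inv_eq[OF is_chart_inj_on[OF charts]] \<open>c \<in> A\<close> by (auto simp: V_def)
  ultimately show ?thesis
    using has_vector_derivative_transform_within_open[OF *] by blast
qed

lemma piecewise_C1_curve_comp:
  assumes "piecewise_C1_curve A \<gamma>"
  shows "piecewise_C1_curve A (\<phi> \<circ> \<gamma>)"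
proof -
  obtain S where "finite S" and
    C1: "\<And>c. c \<in> A \<Longrightarrow> (snd c \<circ> \<gamma>) C1_differentiable_on ({t\<in>{0..1}. \<gamma> t \<in> fst c} - S)"
    and cont: "continuous_on {0..1} \<gamma>"
    using assms by (auto simp: piecewise_C1_curve_def)
  have cont': "continuous_on {0<..<1} \<gamma>"
    using cont by (rule continuous_on_subset) auto
  \<comment> \<open>The end points join the exceptional set because the derivatives are two-sided,
    while \<open>\<gamma>\<close> is controlled only on the closed interval.\<close>
  have "(snd c' \<circ> (\<phi> \<circ> \<gamma>)) C1_differentiable_on ({t\<in>{0..1}. (\<phi> \<circ> \<gamma>) t \<in> fst c'} - (S \<union> {0,1}))"
    (is "_ C1_differentiable_on ?R") if c': "c' \<in> A" for c'
    unfolding C1_differentiable_on_eq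
  proof (intro conjI ballI)
    fix t assume t: "t \<in> ?R"
    obtain c where c: "c \<in> A" "\<gamma> t \<in> fst c" using cover by blast
    have "(snd c \<circ> \<gamma>) differentiable (at t)"
      using C1[OF c(1)] t c by (auto simp: C1_differentiable_on_eq)
    with vector_derivative_chart_comp[OF c(1) c' c(2) _ _ _ cont'] t
    show "(snd c' \<circ> (\<phi> \<circ> \<gamma>)) differentiable (at t)"
      by (auto simp: o_def intro: differentiableI_vector)
  next
    show "continuous_on ?R (\<lambda>t. vector_derivative (snd c' \<circ> (\<phi> \<circ> \<gamma>)) (at t))"
      unfolding continuous_on_eq_continuous_within
    proof
      fix t assume t: "t \<in> ?R"
      obtain c where c: "c \<in> A" "\<gamma> t \<in> fst c" using cover by blast
      let ?\<psi> = "snd c' \<circ> \<phi> \<circ> chart_inv c"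
      obtain N where N: "open N" "snd c (\<gamma> t) \<in> N" "N \<subseteq> snd c ` (fst c \<inter> \<phi> -` fst c')"
        and N_diff: "\<And>z. z \<in> N \<Longrightarrow> ?\<psi> differentiable (at z)"
        and N_cont: "\<And>v. continuous_on N (\<lambda>z. frechet_derivative ?\<psi> (at z) v)"
        using C1_local[OF c(1) c' c(2)] t by auto
      define V where "V = {0<..<1} \<inter> \<gamma> -` (fst c \<inter> snd c -` N)"
      have op: "open (fst c \<inter> snd c -` N)"
        using is_chart_continuous_on[OF charts[OF c(1)]] N(1) continuous_open_preimage by blast
      then have V: "open V" "t \<in> V"
        using continuous_open_preimage[OF cont' open_greaterThanLessThan op] t N(2) c
        unfolding V_def by auto
      let ?v = "\<lambda>s. vector_derivative (snd c \<circ> \<gamma>) (at s)"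
      let ?D = "\<lambda>s. frechet_derivative ?\<psi> (at (snd c (\<gamma> s)))"
      have V_fst: "\<gamma> s \<in> fst c" "snd c (\<gamma> s) \<in> N" "s \<in> {0<..<1}" if "s \<in> V" for s
        using that by (auto simp: V_def)
      \<comment> \<open>Continuity of the differential is known only for a fixed vector. Expanding
        the velocity in the basis separates the moving vector from the moving base point.\<close>
      have expand: "vector_derivative (snd c' \<circ> (\<phi> \<circ> \<gamma>)) (at s) = (\<Sum>b\<in>Basis. (?v s \<bullet> b) *\<^sub>R ?D s b)"
        if s: "s \<in> ?R \<inter> V" for s
      proof -
        have "(snd c \<circ> \<gamma>) differentiable (at s)"
          using C1[OF c(1)] s V_fst by (auto simp: C1_differentiable_on_eq)
        with vector_derivative_chart_comp[OF c(1) c' _ _ _ _ cont'] s V_fst[of s]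
        have "vector_derivative (snd c' \<circ> (\<phi> \<circ> \<gamma>)) (at s) = ?D s (?v s)"
          by (auto intro!: vector_derivative_at)
        moreover have "linear (?D s)"
          using N_diff V_fst s by (auto intro: linear_frechet_derivative)
        then have "?D s (?v s) = (\<Sum>b\<in>Basis. (?v s \<bullet> b) *\<^sub>R ?D s b)"
          by (subst euclidean_representation[symmetric, of "?v s"]) (simp add: linear_sum linear_scale)
        ultimately show ?thesis by simp
      qed
      have "continuous_on (?R \<inter> V) ?v"
        using C1[OF c(1)] V_fst by (auto simp: C1_differentiable_on_eq elim!: continuous_on_subset)
      moreover have "continuous_on (?R \<inter> V) (\<lambda>s. ?D s b)" for b
      proof -
        have "?R \<inter> V \<subseteq> {0<..<1}" "\<gamma> ` (?R \<inter> V) \<subseteq> fst c"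
          using V_fst by blast+
        then have "continuous_on (?R \<inter> V) \<gamma>" "\<gamma> ` (?R \<inter> V) \<subseteq> fst c"
          using continuous_on_subset[OF cont'] by blast+
        then have "continuous_on (?R \<inter> V) (\<lambda>s. snd c (\<gamma> s))"
          using continuous_on_compose2[OF is_chart_continuous_on(1)[OF charts[OF c(1)]]] by blast
        moreover have "(\<lambda>s. snd c (\<gamma> s)) ` (?R \<inter> V) \<subseteq> N"
          using V_fst by auto
        ultimately show ?thesis
          by (rule continuous_on_compose2[OF N_cont[of b], of "?R \<inter> V" "\<lambda>s. snd c (\<gamma> s)"])
      qed
      ultimately have "continuous_on (?R \<inter> V) (\<lambda>s. \<Sum>b\<in>Basis. (?v s \<bullet> b) *\<^sub>R ?D s b)"
        by (intro continuous_intros)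
      then have "continuous_on (?R \<inter> V) (\<lambda>s. vector_derivative (snd c' \<circ> (\<phi> \<circ> \<gamma>)) (at s))"
        using expand by (metis (no_types, lifting) continuous_on_cong)
      then have "continuous (at t within ?R \<inter> V) (\<lambda>t. vector_derivative (snd c' \<circ> (\<phi> \<circ> \<gamma>)) (at t))"
        using t V unfolding continuous_on_eq_continuous_within by blast
      moreover have "at t within ?R \<inter> V = at t within ?R"
        using V by (intro at_within_nhd[of t V]) auto
      ultimately show "continuous (at t within ?R) (\<lambda>t. vector_derivative (snd c' \<circ> (\<phi> \<circ> \<gamma>)) (at t))"
        by metis
    qed
  qed
  moreover have "continuous_on {0..1} (\<phi> \<circ> \<gamma>)"
    using cont continuous continuous_on_compose continuous_on_subset by blast
  moreover have "finite (S \<union> {0,1})"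
    using \<open>finite S\<close> by simp
  ultimately show ?thesis
    unfolding piecewise_C1_curve_def by blast
qed

text \<open>The integrands agree off the finite exceptional set and the two end points, which
  together have measure zero.\<close>

lemma curve_length_comp:
  assumes "piecewise_C1_curve A \<gamma>" "preserves_metric A g \<phi>"
  shows "curve_length A g (\<phi> \<circ> \<gamma>) = curve_length A g \<gamma>"
proof -
  obtain S where "finite S" and
    C1: "\<And>c. c \<in> A \<Longrightarrow> (snd c \<circ> \<gamma>) C1_differentiable_on ({t\<in>{0..1}. \<gamma> t \<in> fst c} - S)"
    and cont: "continuous_on {0..1} \<gamma>"
    using assms by (auto simp: piecewise_C1_curve_def)
  have cont': "continuous_on {0<..<1} \<gamma>"
    using cont by (rule continuous_on_subset) auto
  have "speed A g (\<phi> \<circ> \<gamma>) t = speed A g \<gamma> t" if t: "t \<in> {0..1} - (S \<union> {0,1})" for t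
  proof -
    \<comment> \<open>\<open>speed\<close> selects its charts by choice, independently for the two
      curves. As \<open>preserves_metric\<close> speaks of every pair of charts, the selected ones
      can be compared directly.\<close>
    define c where "c = (SOME c. c \<in> A \<and> \<gamma> t \<in> fst c)"
    define c' where "c' = (SOME c. c \<in> A \<and> (\<phi> \<circ> \<gamma>) t \<in> fst c)"
    have c: "c \<in> A \<and> \<gamma> t \<in> fst c"
      unfolding c_def by (rule someI_ex) (use cover in blast)
    have c': "c' \<in> A \<and> (\<phi> \<circ> \<gamma>) t \<in> fst c'"
      unfolding c'_def by (rule someI_ex) (use cover in blast)
    have "(snd c \<circ> \<gamma>) differentiable (at t)"
      using C1 c t by (auto simp: C1_differentiable_on_eq)
    with vector_derivative_chart_comp[OF _ _ _ _ _ _ cont', of c c' t] t c c'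
    have "vector_derivative (snd c' \<circ> (\<phi> \<circ> \<gamma>)) (at t) =
        frechet_derivative (snd c' \<circ> \<phi> \<circ> chart_inv c) (at (snd c (\<gamma> t)))
          (vector_derivative (snd c \<circ> \<gamma>) (at t))"
      by (auto intro!: vector_derivative_at)
    with assms(2) c c' show ?thesis
      unfolding speed_def c_def[symmetric] c'_def[symmetric] Let_def preserves_metric_def
      by simp
  qed
  moreover have "AE t in lborel. t \<notin> S \<union> {0,1}"
    using \<open>finite S\<close> by (intro AE_not_in countable_imp_null_set_lborel) (simp add: countable_finite)
  ultimately show ?thesis
    unfolding curve_length_def by (intro nn_integral_cong_AE) (auto simp: indicator_def)
qed

text \<open>Composition with \<phi> turns every competitor from \<open>p\<close> to \<open>q\<close>
  into one of the same length between the images. Other curves between the images may be shorter,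
  hence only an inequality.\<close>

lemma riemannian_dist_le:
  assumes "preserves_metric A g \<phi>"
  shows "riemannian_dist A g (\<phi> p) (\<phi> q) \<le> riemannian_dist A g p q"
  unfolding riemannian_dist_def
proof (rule INF_mono)
  fix \<gamma> assume "\<gamma> \<in> {\<gamma>. piecewise_C1_curve A \<gamma> \<and> \<gamma> 0 = p \<and> \<gamma> 1 = q}"
  then show "\<exists>\<gamma>'\<in>{\<gamma>. piecewise_C1_curve A \<gamma> \<and> \<gamma> 0 = \<phi> p \<and> \<gamma> 1 = \<phi> q}.
      curve_length A g \<gamma>' \<le> curve_length A g \<gamma>"
    using assms by (intro bexI[of _ "\<phi> \<circ> \<gamma>"]) (auto simp: curve_length_comp piecewise_C1_curve_comp)
qed

end


text \<open>In a product chart around \<open>(x, p)\<close> the map \<open>act x\<close> is a slice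
  of the coordinate expression of the joint action, taken at the coordinates of \<open>x\<close>.
  Smoothness of the joint action thus gives the local condition of the locale.\<close>

lemma smooth_isometric_action_smooth_self_map:
  fixes A :: "('a::metric_space, real ^ 'n) chart set" and B :: "('g, 'e::euclidean_space) chart set"
  assumes A: "smooth_atlas UNIV (euclidean :: 'a topology) A"
    and B: "smooth_atlas E T B" "topspace T = carrier G"
    and act: "smooth_isometric_action G T B A g act" and x: "x \<in> carrier G"
  shows "smooth_self_map A (act x)"
proof
  have smooth: "smooth_map (prod_topology T euclidean) (prod_atlas B A) euclidean A (\<lambda>(x, p). act x p)"
    using act by (simp add: smooth_isometric_action_def)
  show charts: "is_chart UNIV euclidean c" if "c \<in> A" for c
    using A that by (simp add: smooth_atlas_def)
  show "(\<Union>c\<in>A. fst c) = UNIV"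
    using A by (simp add: smooth_atlas_def)
  have "continuous_map euclidean (prod_topology T euclidean) (\<lambda>p::'a. (x, p))"
    using x B by (simp add: continuous_map_pairwise o_def)
  moreover have "continuous_map (prod_topology T euclidean) euclidean (\<lambda>(x, p). act x p)"
    using smooth by (simp add: smooth_map_def)
  ultimately have "continuous_map euclidean euclidean ((\<lambda>(x, p). act x p) \<circ> (\<lambda>p. (x, p)))"
    by (rule continuous_map_compose)
  then show cont: "continuous_on UNIV (act x)"
    by (simp add: o_def)
  obtain b where b: "b \<in> B" "x \<in> fst b"
    using B x unfolding smooth_atlas_def by blast
  have b_inj: "inj_on (snd b) (fst b)"
    using B b is_chart_inj_on unfolding smooth_atlas_def by blast
  fix c c' p assume c: "c \<in> A" "c' \<in> A" "p \<in> fst c" "act x p \<in> fst c'"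
  define d where "d = (fst b \<times> fst c, map_prod (snd b) (snd c))"
  have c_inj: "inj_on (snd c) (fst c)"
    using charts c is_chart_inj_on by blast
  have "d \<in> prod_atlas B A"
    using b c unfolding prod_atlas_def d_def mem_Collect_eq by (metis prod.collapse)
  let ?W = "snd d ` (fst d \<inter> (\<lambda>(x, p). act x p) -` fst c')"
  let ?f = "snd c' \<circ> (\<lambda>(x, p). act x p) \<circ> chart_inv d"
  have sm: "smooth_on ?W ?f"
    using smooth \<open>d \<in> prod_atlas B A\<close> c by (simp add: smooth_map_def)
  define U where "U = fst c \<inter> act x -` fst c'"
  have "open U"
    using is_chart_continuous_on(2)[OF charts] c cont open_vimage unfolding U_def by blast
  define V where "V = snd c ` U"
  have "open V"
    unfolding V_def using is_chart_open_image[OF charts \<open>open U\<close>] c by (auto simp: U_def)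
  have VW: "(snd b x, z) \<in> ?W" if "z \<in> V" for z
  proof -
    obtain q where "q \<in> U" "z = snd c q" using \<open>z \<in> V\<close> by (auto simp: V_def)
    then show ?thesis
      using b by (intro image_eqI[of _ _ "(x, q)"]) (auto simp: d_def U_def)
  qed
  have pV: "snd c p \<in> V"
    using c by (auto simp: V_def U_def)
  obtain N where
      N: "open N" "snd c p \<in> N" "N \<subseteq> V"
      "\<And>y. y \<in> N \<Longrightarrow> (\<lambda>y. ?f (snd b x, y)) differentiable at y"
      "\<And>v. continuous_on N (\<lambda>y. frechet_derivative (\<lambda>y. ?f (snd b x, y)) (at y) v)"
    using smooth_on_slice[OF sm VW[OF pV] \<open>open V\<close> pV VW] by blast
  have d_inj: "inj_on (snd d) (fst d)"
    using b_inj c_inj by (auto simp: d_def intro: map_prod_inj_on)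
  have eq: "?f (snd b x, z) = (snd c' \<circ> act x \<circ> chart_inv c) z" if "z \<in> N" for z
  proof -
    obtain q where q: "q \<in> U" "z = snd c q" using \<open>z \<in> N\<close> N by (auto simp: V_def)
    have "chart_inv d (snd d (x, q)) = (x, q)"
      using q b by (intro chart_inv_eq d_inj) (auto simp: d_def U_def)
    moreover have "chart_inv c (snd c q) = q"
      using q by (intro chart_inv_eq c_inj) (auto simp: U_def)
    ultimately show ?thesis
      using q by (simp add: d_def)
  qed
  have "N \<subseteq> snd c ` (fst c \<inter> act x -` fst c')"
    using N by (simp add: V_def U_def)
  moreover have "(snd c' \<circ> act x \<circ> chart_inv c) differentiable (at z)" if "z \<in> N" for z
    using frechet_derivative_cong(1)[of N z "\<lambda>z. ?f (snd b x, z)" "snd c' \<circ> act x \<circ> chart_inv c"]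
      N(1) that eq N(4)[OF that] by blast
  moreover have "continuous_on N (\<lambda>z. frechet_derivative (snd c' \<circ> act x \<circ> chart_inv c) (at z) v)" for v
  proof (rule continuous_on_eq[OF N(5)[of v]])
    show "frechet_derivative (\<lambda>y. ?f (snd b x, y)) (at z) v =
        frechet_derivative (snd c' \<circ> act x \<circ> chart_inv c) (at z) v" if "z \<in> N" for z
      using frechet_derivative_cong(2)[of N z "\<lambda>z. ?f (snd b x, z)" "snd c' \<circ> act x \<circ> chart_inv c"]
        N(1) that eq by metis
  qed
  ultimately show "\<exists>N. open N \<and> snd c p \<in> N \<and> N \<subseteq> snd c ` (fst c \<inter> act x -` fst c') \<and>
        (\<forall>z\<in>N. (snd c' \<circ> act x \<circ> chart_inv c) differentiable (at z)) \<and>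
        (\<forall>v. continuous_on N (\<lambda>z. frechet_derivative (snd c' \<circ> act x \<circ> chart_inv c) (at z) v))"
    using N(1,2) by (intro exI[of _ N] conjI ballI allI)
qed

text \<open>The bounds for \<open>x\<close> and for its inverse give both inequalities, since
  \<open>dist\<close> is the Riemannian distance by assumption.\<close>

lemma smooth_isometric_action_dist:
  fixes A :: "('a::metric_space, real ^ 'n) chart set" and B :: "('g, 'e::euclidean_space) chart set"
  assumes M: "closed_connected_riemannian_manifold A g"
    and G: "compact_lie_group G E T B"
    and act: "smooth_isometric_action G T B A g act" and x: "x \<in> carrier G"
  shows "dist (act x p) (act x q) = dist p q"
proof -
  have le: "dist (act x p) (act x q) \<le> dist p q" if x: "x \<in> carrier G" for x p q
  proof -
    have A: "smooth_atlas UNIV (euclidean :: 'a topology) A"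
      using M unfolding closed_connected_riemannian_manifold_def smooth_manifold_def by blast
    have B: "smooth_atlas E T B" "topspace T = carrier G"
      using G unfolding smooth_manifold_def compact_lie_group_def by blast+
    interpret smooth_self_map A "act x"
      by (rule smooth_isometric_action_smooth_self_map[OF A B act x])
    have "preserves_metric A g (act x)"
      using act x by (simp add: smooth_isometric_action_def)
    then have "riemannian_dist A g (act x p) (act x q) \<le> riemannian_dist A g p q"
      by (rule riemannian_dist_le)
    moreover have "riemannian_dist A g p q = ennreal (dist p q)" for p q
      using M by (simp add: closed_connected_riemannian_manifold_def)
    ultimately show ?thesis
      by (simp add: ennreal_le_iff)
  qed
  interpret group_action G UNIV act
    using act by (simp add: smooth_isometric_action_def)
  interpret group G
    using G by (simp add: compact_lie_group_def)
  have "act (inv\<^bsub>G\<^esub> x) (act x r) = r" for r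
    using orbit_sym_aux[OF x] by blast
  with le[OF x, of p q] le[of "inv\<^bsub>G\<^esub> x" "act x p" "act x q"] x show ?thesis
    by simp
qed

section \<open>Cells of the grid\<close>

lemma infnorm_le_iff_cart: "infnorm x \<le> s \<longleftrightarrow> (\<forall>i. \<bar>x $ i\<bar> \<le> s)" for x :: "real ^ 'm"
proof
  assume "\<forall>i. \<bar>x $ i\<bar> \<le> s"
  then show "infnorm x \<le> s"
    unfolding infnorm_cart by (intro cSup_least) auto
qed (use component_le_infnorm_cart order_trans in blast)

lemma infnorm_less_iff_cart: "infnorm x < s \<longleftrightarrow> (\<forall>i. \<bar>x $ i\<bar> < s)" for x :: "real ^ 'm"
proof
  assume lt: "\<forall>i. \<bar>x $ i\<bar> < s"
  \<comment> \<open>Finitely many coordinates attain their maximum, which keeps the inequality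
    strict.\<close>
  define t where "t = Max (range (\<lambda>i. \<bar>x $ i\<bar>))"
  have "t \<in> range (\<lambda>i. \<bar>x $ i\<bar>)"
    unfolding t_def by (intro Max_in) auto
  then have "t < s" using lt by auto
  moreover have "infnorm x \<le> t"
    unfolding infnorm_le_iff_cart t_def by (auto intro!: Max_ge)
  ultimately show "infnorm x < s" by simp
qed (use component_le_infnorm_cart order_le_less_trans in blast)

text \<open>The code of a cell: its lower corner \<open>a\<close> in units of
  \<open>1 / 3 ^ k\<close> and the set \<open>J\<close> of its free directions. The condition of
  lying in the unit cube is left to \<open>grid_cells_iff\<close>.\<close>

definition grid_cell :: "nat \<Rightarrow> ('m::finite \<Rightarrow> nat) \<Rightarrow> 'm set \<Rightarrow> (real ^ 'm) set" where
  "grid_cell k a J = cbox (\<chi> i. real (a i) / 3 ^ k) (\<chi> i. real (a i + of_bool (i \<in> J)) / 3 ^ k)"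

lemma grid_cells_iff:
  "\<sigma> \<in> grid_cells k q \<longleftrightarrow> (\<exists>a J. \<sigma> = grid_cell k a J \<and> card J = q \<and> (\<forall>i. a i + of_bool (i \<in> J) \<le> 3 ^ k))"
  by (auto simp: grid_cells_def grid_cell_def)

lemma mem_grid_cell:
  "x \<in> grid_cell k a J \<longleftrightarrow> (\<forall>i. real (a i) \<le> 3 ^ k * x $ i \<and> 3 ^ k * x $ i \<le> real (a i) + of_bool (i \<in> J))"
  by (simp add: grid_cell_def mem_box_cart field_simps)

lemma cell_center_grid_cell:
  "3 ^ k * cell_center (grid_cell k a J) $ i = real (a i) + of_bool (i \<in> J) / 2"
proof -
  let ?a = "(\<chi> i. real (a i) / 3 ^ k)" and ?b = "(\<chi> i. real (a i + of_bool (i \<in> J)) / 3 ^ k)"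
  have "cbox ?a ?b \<noteq> {}"
    by (simp add: interval_ne_empty_cart divide_right_mono)
  then have le: "\<forall>i\<in>Basis. ?a \<bullet> i \<le> ?b \<bullet> i"
    by (simp only: box_ne_empty)
  have "cell_center (cbox ?a ?b) = midpoint ?a ?b"
    unfolding cell_center_def interval_lowerbound[OF le] interval_upperbound[OF le] ..
  then show ?thesis by (simp add: grid_cell_def midpoint_def field_simps)
qed

text \<open>In a free direction the edge consists of the points within half its length of the
  midpoint; in any other direction the coordinate is that of the center. The radial maps use the
  cell in this form.\<close>

lemma grid_cell_eq_infnorm_ball:
  fixes a :: "'m::finite \<Rightarrow> nat" and k :: nat and J :: "'m set"
  defines "c \<equiv> cell_center (grid_cell k a J)"
  shows "x \<in> grid_cell k a J \<longleftrightarrow> (\<forall>i. i \<notin> J \<longrightarrow> x $ i = c $ i) \<and> infnorm (x - c) \<le> 1 / (2 * 3 ^ k)"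
proof -
  have c: "3 ^ k * c $ i = real (a i) + of_bool (i \<in> J) / 2" for i
    unfolding c_def by (rule cell_center_grid_cell)
  have E1: "infnorm (x - c) \<le> 1 / (2 * 3 ^ k) \<longleftrightarrow> (\<forall>i. \<bar>3 ^ k * x $ i - 3 ^ k * c $ i\<bar> \<le> 1 / 2)"
  proof -
    have "\<bar>(x - c) $ i\<bar> \<le> 1 / (2 * 3 ^ k) \<longleftrightarrow> \<bar>3 ^ k * x $ i - 3 ^ k * c $ i\<bar> \<le> 1 / 2" for i
    proof -
      have "\<bar>3 ^ k * x $ i - 3 ^ k * c $ i\<bar> = 3 ^ k * \<bar>(x - c) $ i\<bar>"
        by (simp add: right_diff_distrib[symmetric] abs_mult)
      then show ?thesis by (simp add: field_simps)
    qed
    then show ?thesis by (simp add: infnorm_le_iff_cart)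
  qed
  have E2: "x $ i = c $ i \<longleftrightarrow> 3 ^ k * x $ i = 3 ^ k * c $ i" for i
    by simp
  have E3: "real (a i) \<le> 3 ^ k * x $ i \<and> 3 ^ k * x $ i \<le> real (a i) + of_bool (i \<in> J) \<longleftrightarrow>
      (i \<notin> J \<longrightarrow> 3 ^ k * x $ i = 3 ^ k * c $ i) \<and> \<bar>3 ^ k * x $ i - 3 ^ k * c $ i\<bar> \<le> 1 / 2" for i
    unfolding c by (cases "i \<in> J"; simp only: of_bool_eq simp_thms; linarith)
  show ?thesis
    by (simp only: mem_grid_cell E1 E2 E3) blast
qed

text \<open>A point is relatively interior to a convex set iff every segment from the set to it can
  be prolonged beyond it within the set. Prolonging from the center forces a norm below
  \<open>s\<close>; conversely, a norm below \<open>s\<close> leaves room for prolonging from any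
  point.\<close>

lemma rel_interior_infnorm_ball:
  fixes c :: "'a::euclidean_space"
  assumes S: "\<And>x. x \<in> S \<longleftrightarrow> x - c \<in> V \<and> infnorm (x - c) \<le> s" and V: "subspace V" and "0 < s"
  shows "x \<in> rel_interior S \<longleftrightarrow> x - c \<in> V \<and> infnorm (x - c) < s"
proof -
  have combo: "(1 - e) *\<^sub>R z + e *\<^sub>R y - c = (1 - e) *\<^sub>R (z - c) + e *\<^sub>R (y - c)" for e z y
    by (simp add: algebra_simps)
  have "c \<in> S" using assms by (simp add: subspace_0 infnorm_0)
  have conv: "convex S"
    unfolding convex_alt
  proof (intro ballI allI impI)
    fix y z u assume yz: "y \<in> S" "z \<in> S" and u: "0 \<le> u \<and> u \<le> (1::real)"
    have "infnorm ((1 - u) *\<^sub>R (y - c) + u *\<^sub>R (z - c)) \<le> (1 - u) * infnorm (y - c) + u * infnorm (z - c)"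
      using infnorm_triangle[of "(1 - u) *\<^sub>R (y - c)" "u *\<^sub>R (z - c)"] u by (simp add: infnorm_mul)
    also have "\<dots> \<le> (1 - u) * s + u * s"
      using yz u S by (intro add_mono mult_left_mono) auto
    also have "\<dots> = s" by (simp add: algebra_simps)
    finally show "(1 - u) *\<^sub>R y + u *\<^sub>R z \<in> S"
      using yz S[of y] S[of z] S[of "(1 - u) *\<^sub>R y + u *\<^sub>R z"] combo[of u y z] V
      by (simp add: subspace_add subspace_scale)
  qed
  show ?thesis
  proof
    assume x: "x \<in> rel_interior S"
    then have xS: "x \<in> S" using rel_interior_subset by blast
    obtain e where e: "e > 1" "(1 - e) *\<^sub>R c + e *\<^sub>R x \<in> S"
      using x convex_rel_interior_iff[OF conv] \<open>c \<in> S\<close> by blast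
    then have "e * infnorm (x - c) \<le> s"
      using S[of "(1 - e) *\<^sub>R c + e *\<^sub>R x"] combo[of e c x] by (simp add: infnorm_mul)
    have "infnorm (x - c) < s"
    proof (rule ccontr)
      assume "\<not> infnorm (x - c) < s"
      then have "s < e * s" "e * s \<le> e * infnorm (x - c)" using e \<open>0 < s\<close> by auto
      then show False using \<open>e * infnorm (x - c) \<le> s\<close> by linarith
    qed
    then show "x - c \<in> V \<and> infnorm (x - c) < s"
      using xS S by blast
  next
    assume x: "x - c \<in> V \<and> infnorm (x - c) < s"
    define r where "r = infnorm (x - c)"
    \<comment> \<open>The solution of \<open>(e - 1) * s + e * r = s\<close>, whose left side is the
      triangle inequality bound for a prolongation starting anywhere in \<open>S\<close>.\<close>
    define e where "e = 2 * s / (s + r)"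
    have r: "0 \<le> r" "r < s" using x by (auto simp: r_def infnorm_pos_le)
    have "e > 1" using r by (simp add: e_def)
    have "s + r \<noteq> 0" using r by simp
    then have "e * (s + r) = 2 * s" by (simp add: e_def)
    then have "(e - 1) * s + e * r = s" by (simp add: algebra_simps)
    note e = \<open>e > 1\<close> this
    have "(1 - e) *\<^sub>R z + e *\<^sub>R x \<in> S" if z: "z \<in> S" for z
    proof -
      have z': "z - c \<in> V" "infnorm (z - c) \<le> s"
        using z unfolding S by simp_all
      have "infnorm ((1 - e) *\<^sub>R (z - c) + e *\<^sub>R (x - c)) \<le> (e - 1) * infnorm (z - c) + e * r"
        using infnorm_triangle[of "(1 - e) *\<^sub>R (z - c)" "e *\<^sub>R (x - c)"] e(1) by (simp add: infnorm_mul r_def)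
      also have "\<dots> \<le> (e - 1) * s + e * r"
        using z'(2) e(1) by simp
      finally have "infnorm ((1 - e) *\<^sub>R (z - c) + e *\<^sub>R (x - c)) \<le> s"
        using e(2) by simp
      moreover have "(1 - e) *\<^sub>R (z - c) + e *\<^sub>R (x - c) \<in> V"
        using x z'(1) V by (simp add: subspace_add subspace_scale)
      ultimately show ?thesis
        unfolding S combo by blast
    qed
    then have "\<forall>z\<in>S. \<exists>e. e > 1 \<and> (1 - e) *\<^sub>R z + e *\<^sub>R x \<in> S"
      using e(1) by metis
    then show "x \<in> rel_interior S"
      using convex_rel_interior_iff[OF conv, of x] \<open>c \<in> S\<close> by auto
  qed
qed

lemma grid_cell_infnorm_ball:
  fixes \<sigma> :: "(real ^ 'm) set"
  assumes "\<sigma> \<in> grid_cells k q"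
  obtains V where "subspace V"
    "\<And>x. x \<in> \<sigma> \<longleftrightarrow> x - cell_center \<sigma> \<in> V \<and> infnorm (x - cell_center \<sigma>) \<le> 1 / (2 * 3 ^ k)"
    "\<And>x. x \<in> rel_interior \<sigma> \<longleftrightarrow> x - cell_center \<sigma> \<in> V \<and> infnorm (x - cell_center \<sigma>) < 1 / (2 * 3 ^ k)"
proof -
  obtain a J where \<sigma>: "\<sigma> = grid_cell k a J" using assms grid_cells_iff by blast
  define V where "V = {v :: real ^ 'm. \<forall>i. i \<notin> J \<longrightarrow> v $ i = 0}"
  have V: "subspace V" by (auto simp: V_def subspace_def)
  have mem: "x \<in> \<sigma> \<longleftrightarrow> x - cell_center \<sigma> \<in> V \<and> infnorm (x - cell_center \<sigma>) \<le> 1 / (2 * 3 ^ k)" for x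
    unfolding \<sigma> grid_cell_eq_infnorm_ball by (auto simp: V_def)
  show thesis
    using that[OF V mem] rel_interior_infnorm_ball[OF mem V] by simp
qed

text \<open>Near the center of \<tau> the scaled coordinates in its free directions are not
  integers, whereas they are integers in the directions fixed in \<sigma>. So \<sigma> is free
  wherever \<tau> is, and equal dimensions force the same directions; the corners are then integers
  less than 1 apart. As \<open>x\<close> is not assumed to lie in \<tau>, this also locates points
  known only to be close to a center.\<close>

lemma grid_cell_eqI:
  assumes "\<sigma> \<in> grid_cells k q" "\<tau> \<in> grid_cells k q" "x \<in> \<sigma>" "infnorm (x - cell_center \<tau>) < 1 / (2 * 3 ^ k)"
  shows "\<sigma> = \<tau>"
proof -
  obtain a J where \<sigma>: "\<sigma> = grid_cell k a J" "card J = q" using assms grid_cells_iff by blast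
  obtain b I where \<tau>: "\<tau> = grid_cell k b I" "card I = q" using assms grid_cells_iff by blast
  have "\<bar>3 ^ k * x $ i - (real (b i) + of_bool (i \<in> I) / 2)\<bar> < 1 / 2" for i
  proof -
    have "\<bar>(x - cell_center \<tau>) $ i\<bar> < 1 / (2 * 3 ^ k)"
      using assms(4) infnorm_less_iff_cart by blast
    moreover have "\<bar>3 ^ k * x $ i - 3 ^ k * cell_center \<tau> $ i\<bar> = 3 ^ k * \<bar>(x - cell_center \<tau>) $ i\<bar>"
      by (simp add: right_diff_distrib[symmetric] abs_mult)
    ultimately show ?thesis
      unfolding \<tau> cell_center_grid_cell by (simp add: field_simps)
  qed
  note near = this
  have in_\<sigma>: "real (a i) \<le> 3 ^ k * x $ i \<and> 3 ^ k * x $ i \<le> real (a i) + of_bool (i \<in> J)" for i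
    using assms(3) unfolding \<sigma> mem_grid_cell by blast
  have "I \<subseteq> J"
  proof
    fix i assume "i \<in> I"
    show "i \<in> J"
    proof (rule ccontr)
      assume "i \<notin> J"
      then have "3 ^ k * x $ i = real (a i)" using in_\<sigma>[of i] by simp
      then have "\<bar>real (a i) - (real (b i) + 1 / 2)\<bar> < 1 / 2"
        using near[of i] \<open>i \<in> I\<close> by simp
      then have "real (b i) < real (a i)" "real (a i) < real (b i + 1)"
        by linarith+
      then show False unfolding of_nat_less_iff by linarith
    qed
  qed
  then have "I = J"
    using \<sigma> \<tau> by (metis card_subset_eq finite)
  moreover have "a i = b i" for i
  proof (cases "i \<in> J")
    case True
    then have "\<bar>3 ^ k * x $ i - (real (b i) + 1 / 2)\<bar> < 1 / 2"
      "real (a i) \<le> 3 ^ k * x $ i \<and> 3 ^ k * x $ i \<le> real (a i) + 1"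
      using near[of i] in_\<sigma>[of i] \<open>I = J\<close> by simp_all
    then have "real (a i) < real (b i + 1)" "real (b i) < real (a i + 1)"
      by linarith+
    then show ?thesis unfolding of_nat_less_iff by linarith
  next
    case False
    then have "\<bar>3 ^ k * x $ i - real (b i)\<bar> < 1 / 2" "3 ^ k * x $ i = real (a i)"
      using near[of i] in_\<sigma>[of i] \<open>I = J\<close> by simp_all
    then show ?thesis by linarith
  qed
  then have "a = b" by blast
  ultimately show ?thesis
    using \<sigma> \<tau> by simp
qed

lemma finite_grid_cells: "finite (grid_cells k q :: (real ^ 'm) set set)"
proof -
  have "finite {a :: 'm \<Rightarrow> nat. \<forall>i. a i \<in> {..3 ^ k}}"
    using finite_set_of_finite_funs[of "UNIV :: 'm set" "{..3 ^ k :: nat}" 0] by simp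
  then have "finite ({a :: 'm \<Rightarrow> nat. \<forall>i. a i \<le> 3 ^ k} \<times> (UNIV :: 'm set set))"
    by simp
  moreover have "grid_cells k q \<subseteq> (\<lambda>(a, J). grid_cell k a J) ` ({a :: 'm \<Rightarrow> nat. \<forall>i. a i \<le> 3 ^ k} \<times> UNIV)"
  proof
    fix \<sigma> :: "(real ^ 'm) set" assume "\<sigma> \<in> grid_cells k q"
    then obtain a J where "\<sigma> = grid_cell k a J" "\<forall>i. a i + of_bool (i \<in> J) \<le> 3 ^ k"
      unfolding grid_cells_iff by blast
    moreover from this have "\<forall>i. a i \<le> 3 ^ k"
      using add_leD1 by blast
    ultimately show "\<sigma> \<in> (\<lambda>(a, J). grid_cell k a J) ` ({a. \<forall>i. a i \<le> 3 ^ k} \<times> UNIV)"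
      by force
  qed
  ultimately show ?thesis
    using finite_subset by blast
qed


text \<open>The lower and the upper corner decide containment, which turns it into inequalities
  between natural numbers.\<close>

lemma grid_cell_subset_iff:
  fixes a b :: "'m::finite \<Rightarrow> nat"
  shows "grid_cell k b I \<subseteq> grid_cell 0 a J \<longleftrightarrow>
    (\<forall>i. 3 ^ k * a i \<le> b i \<and> b i + of_bool (i \<in> I) \<le> 3 ^ k * (a i + of_bool (i \<in> J)))" (is "_ \<longleftrightarrow> ?R")
proof
  assume sub: "grid_cell k b I \<subseteq> grid_cell 0 a J"
  let ?lo = "(\<chi> i. real (b i) / 3 ^ k)" and ?hi = "(\<chi> i. real (b i + of_bool (i \<in> I)) / 3 ^ k)"
  have "?lo \<in> grid_cell k b I" "?hi \<in> grid_cell k b I"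
    by (simp_all add: mem_grid_cell)
  then have "?lo \<in> grid_cell 0 a J" "?hi \<in> grid_cell 0 a J"
    using sub by blast+
  then have *: "real (a i) \<le> real (b i) / 3 ^ k"
      "real (b i + of_bool (i \<in> I)) / 3 ^ k \<le> real (a i + of_bool (i \<in> J))" for i
    by (simp_all add: mem_grid_cell)
  show ?R
  proof
    fix i
    have "real (3 ^ k * a i) \<le> real (b i)"
      "real (b i + of_bool (i \<in> I)) \<le> real (3 ^ k * (a i + of_bool (i \<in> J)))"
      using *[of i] unfolding of_nat_mult of_nat_power
      by (simp_all only: pos_le_divide_eq pos_divide_le_eq zero_less_power zero_less_numeral of_nat_numeral mult.commute)
    then show "3 ^ k * a i \<le> b i \<and> b i + of_bool (i \<in> I) \<le> 3 ^ k * (a i + of_bool (i \<in> J))"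
      unfolding of_nat_le_iff by blast
  qed
next
  assume R: ?R
  show "grid_cell k b I \<subseteq> grid_cell 0 a J"
  proof
    fix x assume x: "x \<in> grid_cell k b I"
    have "real (a i) \<le> x $ i \<and> x $ i \<le> real (a i) + of_bool (i \<in> J)" for i
    proof -
      have "real (3 ^ k * a i) \<le> real (b i)"
        "real (b i + of_bool (i \<in> I)) \<le> real (3 ^ k * (a i + of_bool (i \<in> J)))"
        using R of_nat_le_iff by blast+
      moreover have "real (b i) \<le> 3 ^ k * x $ i" "3 ^ k * x $ i \<le> real (b i) + of_bool (i \<in> I)"
        using x unfolding mem_grid_cell by blast+
      ultimately have "3 ^ k * real (a i) \<le> 3 ^ k * x $ i"
        "3 ^ k * x $ i \<le> 3 ^ k * (real (a i) + of_bool (i \<in> J))"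
        unfolding of_nat_mult of_nat_add of_nat_power of_nat_of_bool of_nat_numeral by linarith+
      then show ?thesis by simp
    qed
    then show "x \<in> grid_cell 0 a J"
      by (simp add: mem_grid_cell)
  qed
qed

lemma rel_interior_grid_cell:
  assumes "\<sigma> \<in> grid_cells k q"
  shows "x \<in> rel_interior \<sigma> \<longleftrightarrow> x \<in> \<sigma> \<and> infnorm (x - cell_center \<sigma>) < 1 / (2 * 3 ^ k)"
proof -
  obtain V where "subspace V"
    "\<And>x. x \<in> \<sigma> \<longleftrightarrow> x - cell_center \<sigma> \<in> V \<and> infnorm (x - cell_center \<sigma>) \<le> 1 / (2 * 3 ^ k)"
    "\<And>x. x \<in> rel_interior \<sigma> \<longleftrightarrow> x - cell_center \<sigma> \<in> V \<and> infnorm (x - cell_center \<sigma>) < 1 / (2 * 3 ^ k)"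
    using grid_cell_infnorm_ball[OF assms] by blast
  then show ?thesis by auto
qed

lemma infnorm_less_grid_cell:
  fixes a :: "'m::finite \<Rightarrow> nat"
  shows "infnorm (x - cell_center (grid_cell k a J)) < 1 / (2 * 3 ^ k) \<longleftrightarrow>
    (\<forall>i. \<bar>3 ^ k * x $ i - (real (a i) + of_bool (i \<in> J) / 2)\<bar> < 1 / 2)"
proof -
  have "\<bar>(x - cell_center (grid_cell k a J)) $ i\<bar> < 1 / (2 * 3 ^ k) \<longleftrightarrow>
      \<bar>3 ^ k * x $ i - (real (a i) + of_bool (i \<in> J) / 2)\<bar> < 1 / 2" for i
  proof -
    have "\<bar>3 ^ k * x $ i - 3 ^ k * cell_center (grid_cell k a J) $ i\<bar> =
        3 ^ k * \<bar>(x - cell_center (grid_cell k a J)) $ i\<bar>"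
      by (simp add: right_diff_distrib[symmetric] abs_mult)
    then show ?thesis
      unfolding cell_center_grid_cell by (simp add: field_simps)
  qed
  then show ?thesis
    by (simp only: infnorm_less_iff_cart)
qed

section \<open>The subdivided complex and its codimension-one skeleton\<close>

lemma cubical_subcomplexD:
  assumes "cubical_subcomplex l K" "\<sigma> \<in> K"
  shows "\<exists>a J. grid_cell 0 a J \<in> K \<and> \<sigma> \<subseteq> grid_cell 0 a J \<and> card J = l \<and>
    (\<forall>i. a i + of_bool (i \<in> J) \<le> 1)"
proof -
  have "\<forall>\<sigma>\<in>K. \<exists>\<tau>\<in>K \<inter> grid_cells 0 l. \<sigma> \<subseteq> \<tau>"
    using assms(1) unfolding cubical_subcomplex_def by (elim conjE)
  then obtain \<tau> where \<tau>: "\<tau> \<in> K" "\<tau> \<in> grid_cells 0 l" "\<sigma> \<subseteq> \<tau>"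
    using assms(2) by blast
  then obtain a J where "\<tau> = grid_cell 0 a J" "card J = l" "\<forall>i. a i + of_bool (i \<in> J) \<le> 3 ^ 0"
    unfolding grid_cells_iff by blast
  with \<tau> show ?thesis by (metis power_0)
qed

lemma Union_subdiv_cells:
  assumes "cubical_subcomplex l K"
  shows "\<Union>(subdiv_cells K k l) = \<Union>K"
proof
  show "\<Union>(subdiv_cells K k l) \<subseteq> \<Union>K"
    by (auto simp: subdiv_cells_def)
  show "\<Union>K \<subseteq> \<Union>(subdiv_cells K k l)"
  proof
    fix x assume "x \<in> \<Union>K"
    then obtain \<sigma> where \<sigma>: "\<sigma> \<in> K" "x \<in> \<sigma>" by blast
    obtain a J where J: "grid_cell 0 a J \<in> K" "\<sigma> \<subseteq> grid_cell 0 a J" "card J = l"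
        "\<forall>i. a i + of_bool (i \<in> J) \<le> 1"
      using cubical_subcomplexD[OF assms \<sigma>(1)] by (elim exE conjE)
    note a = J(1) subsetD[OF J(2) \<sigma>(2)] J(3,4)
    \<comment> \<open>Rounding down gives the corner of a small cell around \<open>x\<close>. The
      cap \<open>3 ^ k - 1\<close> handles the coordinate 1, from which a further step would leave
      the cube; in a fixed direction the coordinate is already the integer
      \<open>a i\<close>.\<close>
    define b where "b i = (if i \<in> J then min (nat \<lfloor>3 ^ k * x $ i\<rfloor>) (3 ^ k - 1) else 3 ^ k * a i)" for i
    have b: "3 ^ k * a i \<le> b i \<and> b i + of_bool (i \<in> J) \<le> 3 ^ k * (a i + of_bool (i \<in> J)) \<and>
        b i + of_bool (i \<in> J) \<le> 3 ^ k \<and>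
        real (b i) \<le> 3 ^ k * x $ i \<and> 3 ^ k * x $ i \<le> real (b i) + of_bool (i \<in> J)" for i
    proof (cases "i \<in> J")
      case True
      then have "a i = 0" using a(4)[rule_format, of i] by simp
      have x01: "0 \<le> x $ i" "x $ i \<le> 1"
        using a(2) True \<open>a i = 0\<close> unfolding mem_grid_cell by (auto dest: spec[of _ i])
      have bi: "b i = min (nat \<lfloor>3 ^ k * x $ i\<rfloor>) (3 ^ k - 1)" using True by (simp add: b_def)
      have "(1 :: nat) \<le> 3 ^ k" by simp
      then have "b i + 1 \<le> 3 ^ k" unfolding bi by linarith
      moreover have "real (b i) \<le> 3 ^ k * x $ i"
      proof -
        have "real (b i) \<le> real (nat \<lfloor>3 ^ k * x $ i\<rfloor>)" unfolding bi of_nat_le_iff by simp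
        also have "\<dots> \<le> 3 ^ k * x $ i" using x01 by (intro of_nat_floor) simp
        finally show ?thesis .
      qed
      moreover have "3 ^ k * x $ i \<le> real (b i) + 1"
      proof (cases "nat \<lfloor>3 ^ k * x $ i\<rfloor> \<le> 3 ^ k - 1")
        case True
        then show ?thesis unfolding bi using x01 by (simp add: min_def)
      next
        case False
        then have "b i = 3 ^ k - 1" by (simp add: bi)
        then have "real (b i) + 1 = 3 ^ k" by (simp add: of_nat_diff)
        then show ?thesis using x01 by simp
      qed
      ultimately show ?thesis using True \<open>a i = 0\<close> by simp
    next
      case False
      have "a i \<le> 1" using a(4)[rule_format, of i] by simp
      moreover have "x $ i = real (a i)"
        using a(2) False unfolding mem_grid_cell by (auto dest: spec[of _ i] intro: antisym)
      ultimately show ?thesis using False by (simp add: b_def)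
    qed
    have "grid_cell k b J \<subseteq> grid_cell 0 a J"
      unfolding grid_cell_subset_iff using b by blast
    moreover have "x \<in> grid_cell k b J"
      unfolding mem_grid_cell using b by blast
    moreover have "grid_cell k b J \<in> grid_cells k l"
      unfolding grid_cells_iff using b a(3) by blast
    ultimately show "x \<in> \<Union>(subdiv_cells K k l)"
      using a(1) unfolding subdiv_cells_def by blast
  qed
qed

text \<open>A subdivided face of dimension \<open>l - 1\<close> inside an \<open>l\<close>-cell of
  \<open>K\<close> misses exactly one free direction of the latter; thickening the face there yields
  a subdivided \<open>l\<close>-cell with the face on its boundary. Conversely, a boundary point has
  a coordinate at an end of its range, and fixing that coordinate gives the face.\<close>

lemma Union_subdiv_faces:
  fixes K :: "(real ^ 'm) set set"
  assumes K: "cubical_subcomplex l K" and "1 \<le> l"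
  shows "\<Union>(subdiv_cells K k (l - 1)) = (\<Union>\<sigma>\<in>subdiv_cells K k l. \<sigma> - rel_interior \<sigma>)"
proof
  show "\<Union>(subdiv_cells K k (l - 1)) \<subseteq> (\<Union>\<sigma>\<in>subdiv_cells K k l. \<sigma> - rel_interior \<sigma>)"
  proof
    fix x assume "x \<in> \<Union>(subdiv_cells K k (l - 1))"
    then obtain \<eta> \<tau> where \<eta>: "\<eta> \<in> grid_cells k (l - 1)" "x \<in> \<eta>" "\<tau> \<in> K" "\<eta> \<subseteq> \<tau>"
      unfolding subdiv_cells_def by blast
    obtain b I where b: "\<eta> = grid_cell k b I" "card I = l - 1" "\<forall>i. b i + of_bool (i \<in> I) \<le> 3 ^ k"
      using \<eta>(1) unfolding grid_cells_iff by blast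
    obtain a J where a: "grid_cell 0 a J \<in> K" "\<tau> \<subseteq> grid_cell 0 a J" "card J = l"
        "\<forall>i. a i + of_bool (i \<in> J) \<le> 1"
      using cubical_subcomplexD[OF K \<eta>(3)] by (elim exE conjE)
    have "grid_cell k b I \<subseteq> grid_cell 0 a J" using \<eta>(4) a(2) b(1) by blast
    then have ab: "3 ^ k * a i \<le> b i" "b i + of_bool (i \<in> I) \<le> 3 ^ k * (a i + of_bool (i \<in> J))" for i
      unfolding grid_cell_subset_iff by blast+
    have "I \<subseteq> J"
    proof
      fix i assume "i \<in> I"
      then have "3 ^ k * a i + 1 \<le> 3 ^ k * (a i + of_bool (i \<in> J))"
        using ab(1)[of i] ab(2)[of i] by simp
      then show "i \<in> J" by (cases "i \<in> J") auto
    qed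
    have "\<not> J \<subseteq> I"
    proof
      assume "J \<subseteq> I"
      then have "card J \<le> card I" by (intro card_mono) auto
      then show False using a(3) b(2) \<open>1 \<le> l\<close> by linarith
    qed
    then obtain j where j: "j \<in> J" "j \<notin> I" by blast
    have "card (insert j I) = l" using j b(2) \<open>1 \<le> l\<close> by simp
    then have J: "J = insert j I"
      using card_subset_eq[of J "insert j I"] \<open>I \<subseteq> J\<close> j(1) a(3) by auto
    have aj: "a j = 0" using a(4)[rule_format, of j] j by simp
    have bj: "b j \<le> 3 ^ k" using b(3)[rule_format, of j] by simp
    \<comment> \<open>The face is thickened downwards and becomes an upper face. If
      \<open>b j = 0\<close>, truncated subtraction leaves the corner in place, and the cell lies
      above the face instead.\<close>
    define b' where "b' = b(j := b j - 1)"
    have b'j: "b' j = b j - 1" and b'i: "i \<noteq> j \<Longrightarrow> b' i = b i" for i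
      by (simp_all add: b'_def)
    have one: "(1::nat) \<le> 3 ^ k" by simp
    have "b' i + of_bool (i \<in> J) \<le> 3 ^ k \<and> 3 ^ k * a i \<le> b' i \<and>
        b' i + of_bool (i \<in> J) \<le> 3 ^ k * (a i + of_bool (i \<in> J))" for i
    proof (cases "i = j")
      case True
      have "b j - 1 + 1 \<le> 3 ^ k" using bj one by linarith
      then show ?thesis using True aj j by (simp add: b'j)
    next
      case False
      then have "i \<in> J \<longleftrightarrow> i \<in> I" using J by blast
      then show ?thesis using False ab[of i] b(3)[rule_format, of i] by (simp add: b'i)
    qed
    then have "grid_cell k b' J \<in> grid_cells k l" "grid_cell k b' J \<subseteq> grid_cell 0 a J"
      unfolding grid_cells_iff grid_cell_subset_iff using a(3) by blast+
    then have cell: "grid_cell k b' J \<in> subdiv_cells K k l"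
      using a(1) unfolding subdiv_cells_def by blast
    have x: "real (b i) \<le> 3 ^ k * x $ i" "3 ^ k * x $ i \<le> real (b i) + of_bool (i \<in> I)" for i
      using \<eta>(2) unfolding b(1) mem_grid_cell by blast+
    have xj: "3 ^ k * x $ j = real (b j)"
      using x[of j] j by simp
    have xmem: "x \<in> grid_cell k b' J"
      unfolding mem_grid_cell
    proof
      fix i
      show "real (b' i) \<le> 3 ^ k * x $ i \<and> 3 ^ k * x $ i \<le> real (b' i) + of_bool (i \<in> J)"
      proof (cases "i = j")
        case True
        have "real (b j - 1) \<le> real (b j)" "real (b j) \<le> real (b j - 1) + 1" by linarith+
        then show ?thesis using True xj j by (simp add: b'j)
      next
        case False
        then have "i \<in> J \<longleftrightarrow> i \<in> I" using J by blast
        then show ?thesis using False x[of i] by (simp add: b'i)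
      qed
    qed
    have "\<not> \<bar>3 ^ k * x $ j - (real (b' j) + of_bool (j \<in> J) / 2)\<bar> < 1 / 2"
    proof (cases "b j = 0")
      case True
      then show ?thesis using j xj by (simp add: b'j)
    next
      case False
      then have "real (b j) = real (b' j) + 1" by (simp add: b'j)
      then show ?thesis using j xj by simp
    qed
    then have "x \<notin> rel_interior (grid_cell k b' J)"
      unfolding rel_interior_grid_cell[OF \<open>grid_cell k b' J \<in> grid_cells k l\<close>] infnorm_less_grid_cell
      by blast
    then show "x \<in> (\<Union>\<sigma>\<in>subdiv_cells K k l. \<sigma> - rel_interior \<sigma>)"
      using cell xmem by blast
  qed
next
  show "(\<Union>\<sigma>\<in>subdiv_cells K k l. \<sigma> - rel_interior \<sigma>) \<subseteq> \<Union>(subdiv_cells K k (l - 1))"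
  proof
    fix x assume "x \<in> (\<Union>\<sigma>\<in>subdiv_cells K k l. \<sigma> - rel_interior \<sigma>)"
    then obtain \<sigma> \<tau> where \<sigma>: "\<sigma> \<in> grid_cells k l" "\<tau> \<in> K" "\<sigma> \<subseteq> \<tau>" "x \<in> \<sigma>" "x \<notin> rel_interior \<sigma>"
      unfolding subdiv_cells_def by blast
    obtain b J where b: "\<sigma> = grid_cell k b J" "card J = l" "\<forall>i. b i + of_bool (i \<in> J) \<le> 3 ^ k"
      using \<sigma>(1) unfolding grid_cells_iff by blast
    have x: "real (b i) \<le> 3 ^ k * x $ i" "3 ^ k * x $ i \<le> real (b i) + of_bool (i \<in> J)" for i
      using \<sigma>(4) unfolding b(1) mem_grid_cell by blast+
    obtain j where j: "\<not> \<bar>3 ^ k * x $ j - (real (b j) + of_bool (j \<in> J) / 2)\<bar> < 1 / 2"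
      using \<sigma>(4,5) unfolding rel_interior_grid_cell[OF \<sigma>(1)] unfolding b(1) infnorm_less_grid_cell
      by blast
    have jJ: "j \<in> J"
    proof (rule ccontr)
      assume "j \<notin> J"
      then show False using j x[of j] by simp
    qed
    then have "\<not> \<bar>3 ^ k * x $ j - (real (b j) + 1 / 2)\<bar> < 1 / 2"
        "real (b j) \<le> 3 ^ k * x $ j" "3 ^ k * x $ j \<le> real (b j) + 1"
      using j x[of j] by simp_all
    \<comment> \<open>Within an interval of length 1, a distance of at least 1/2 from the middle
      leaves only the two ends.\<close>
    then have "3 ^ k * x $ j = real (b j) \<or> 3 ^ k * x $ j = real (b j + 1)"
      by (simp only: of_nat_add of_nat_1) argo
    then obtain v where v: "3 ^ k * x $ j = real v" "v = b j \<or> v = b j + 1"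
      by metis
    define b' where "b' = b(j := v)"
    have b'j: "b' j = v" and b'i: "i \<noteq> j \<Longrightarrow> b' i = b i" for i
      by (simp_all add: b'_def)
    have le: "b' i + of_bool (i \<in> J - {j}) \<le> 3 ^ k" for i
      using b(3)[rule_format, of i] v(2) jJ by (cases "i = j") (auto simp: b'_def)
    have "card (J - {j}) = l - 1"
      using jJ b(2) by simp
    with le have "grid_cell k b' (J - {j}) \<in> grid_cells k (l - 1)"
      unfolding grid_cells_iff by blast
    moreover have "grid_cell k b' (J - {j}) \<subseteq> grid_cell k b J"
    proof
      fix y assume y: "y \<in> grid_cell k b' (J - {j})"
      show "y \<in> grid_cell k b J"
        unfolding mem_grid_cell
      proof
        fix i
        have yi: "real (b' i) \<le> 3 ^ k * y $ i \<and> 3 ^ k * y $ i \<le> real (b' i) + of_bool (i \<in> J - {j})"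
          using y unfolding mem_grid_cell by blast
        show "real (b i) \<le> 3 ^ k * y $ i \<and> 3 ^ k * y $ i \<le> real (b i) + of_bool (i \<in> J)"
        proof (cases "i = j")
          case True
          then show ?thesis using yi v(2) jJ by (auto simp: b'j)
        next
          case False
          then show ?thesis using yi by (simp add: b'i)
        qed
      qed
    qed
    moreover have "x \<in> grid_cell k b' (J - {j})"
      unfolding mem_grid_cell
    proof
      fix i
      show "real (b' i) \<le> 3 ^ k * x $ i \<and> 3 ^ k * x $ i \<le> real (b' i) + of_bool (i \<in> J - {j})"
        using x[of i] v(1) by (cases "i = j") (simp_all add: b'_def)
    qed
    ultimately show "x \<in> \<Union>(subdiv_cells K k (l - 1))"
      using \<sigma>(2,3) unfolding subdiv_cells_def b(1) by blast
  qed
qed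

section \<open>Estimates across neighbouring and distant cells\<close>

lemma median_bounds:
  fixes x y p lo hi :: real
  defines "m \<equiv> max (min x y) (min (max x y) p)"
  shows "lo \<le> x \<Longrightarrow> lo \<le> p \<Longrightarrow> lo \<le> m" "x \<le> hi \<Longrightarrow> p \<le> hi \<Longrightarrow> m \<le> hi"
    "lo \<le> y \<Longrightarrow> lo \<le> p \<Longrightarrow> lo \<le> m" "y \<le> hi \<Longrightarrow> p \<le> hi \<Longrightarrow> m \<le> hi"
    "\<bar>x - m\<bar> \<le> \<bar>x - y\<bar>" "\<bar>m - y\<bar> \<le> \<bar>x - y\<bar>"
  unfolding m_def by (auto simp: min_def max_def)

text \<open>In every direction the scaled cells span intervals with integer ends. If all pairs
  overlap, clamping a common point to the box spanned by \<open>x\<close> and \<open>y\<close> gives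
  a common point of the cells; if some pair is disjoint, integrality makes the gap at least
  1.\<close>

lemma grid_cells_meet_or_far:
  fixes \<sigma> \<tau> :: "(real ^ 'm) set"
  assumes "\<sigma> \<in> grid_cells k q" "\<tau> \<in> grid_cells k r" "x \<in> \<sigma>" "y \<in> \<tau>"
  shows "(\<exists>w\<in>\<sigma> \<inter> \<tau>. norm (x - w) \<le> norm (x - y) \<and> norm (w - y) \<le> norm (x - y)) \<or> 1 / 3 ^ k \<le> norm (x - y)"
proof -
  obtain a J where \<sigma>: "\<sigma> = grid_cell k a J" using assms(1) grid_cells_iff by blast
  obtain b I where \<tau>: "\<tau> = grid_cell k b I" using assms(2) grid_cells_iff by blast
  let ?a' = "\<lambda>i. a i + of_bool (i \<in> J)" and ?b' = "\<lambda>i. b i + of_bool (i \<in> I)"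
  have x: "real (a i) \<le> 3 ^ k * x $ i" "3 ^ k * x $ i \<le> real (?a' i)" for i
    using assms(3) unfolding \<sigma> mem_grid_cell by auto
  have y: "real (b i) \<le> 3 ^ k * y $ i" "3 ^ k * y $ i \<le> real (?b' i)" for i
    using assms(4) unfolding \<tau> mem_grid_cell by auto
  show ?thesis
  proof (cases "\<forall>i. b i \<le> ?a' i \<and> a i \<le> ?b' i")
    case True
    \<comment> \<open>The larger of the two lower ends lies in both intervals.\<close>
    define p where "p i = real (max (a i) (b i))" for i
    define w where "w = (\<chi> i. max (min (x $ i) (y $ i)) (min (max (x $ i) (y $ i)) (p i / 3 ^ k)))"
    have w: "3 ^ k * w $ i =
        max (min (3 ^ k * x $ i) (3 ^ k * y $ i)) (min (max (3 ^ k * x $ i) (3 ^ k * y $ i)) (p i))" for i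
      by (simp add: w_def max_mult_distrib_left min_mult_distrib_left)
    have p: "real (a i) \<le> p i" "real (b i) \<le> p i" "p i \<le> real (?a' i)" "p i \<le> real (?b' i)" for i
      unfolding p_def of_nat_le_iff using True[rule_format, of i] by auto
    have *: "\<bar>(x - w) $ i\<bar> \<le> \<bar>(x - y) $ i\<bar>" "\<bar>(w - y) $ i\<bar> \<le> \<bar>(x - y) $ i\<bar>" for i
      unfolding vector_minus_component w_def vec_lambda_beta by (rule median_bounds(5,6))+
    have "real (a i) \<le> 3 ^ k * w $ i" "3 ^ k * w $ i \<le> real (?a' i)"
      "real (b i) \<le> 3 ^ k * w $ i" "3 ^ k * w $ i \<le> real (?b' i)" for i
      unfolding w
      by (rule median_bounds(1)[OF x(1) p(1)] median_bounds(2)[OF x(2) p(3)]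
        median_bounds(3)[OF y(1) p(2)] median_bounds(4)[OF y(2) p(4)])+
    then have "w \<in> \<sigma>" "w \<in> \<tau>"
      unfolding \<sigma> \<tau> mem_grid_cell by simp_all
    moreover have "norm (x - w) \<le> norm (x - y)" "norm (w - y) \<le> norm (x - y)"
      using * by (auto intro!: norm_le_componentwise_cart)
    ultimately show ?thesis by blast
  next
    case False
    then obtain i where "?a' i < b i \<or> ?b' i < a i" by (meson not_le)
    then have "?a' i + 1 \<le> b i \<or> ?b' i + 1 \<le> a i" by linarith
    then have "real (?a' i) + 1 \<le> real (b i) \<or> real (?b' i) + 1 \<le> real (a i)"
      by (metis of_nat_1 of_nat_add of_nat_le_iff)
    then have "1 \<le> \<bar>3 ^ k * x $ i - 3 ^ k * y $ i\<bar>"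
      using x[of i] y[of i] by linarith
    also have "\<dots> = 3 ^ k * \<bar>(x - y) $ i\<bar>"
      by (simp add: right_diff_distrib[symmetric] abs_mult)
    also have "\<dots> \<le> 3 ^ k * norm (x - y)"
      by (intro mult_left_mono component_le_norm_cart) simp
    finally show ?thesis by (simp add: field_simps)
  qed
qed

lemma cell_center_in_grid_cell:
  assumes "\<sigma> \<in> grid_cells k q"
  shows "cell_center \<sigma> \<in> rel_interior \<sigma>"
proof -
  obtain V where V: "subspace V"
    "\<And>x. x \<in> \<sigma> \<longleftrightarrow> x - cell_center \<sigma> \<in> V \<and> infnorm (x - cell_center \<sigma>) \<le> 1 / (2 * 3 ^ k)"
    "\<And>x. x \<in> rel_interior \<sigma> \<longleftrightarrow> x - cell_center \<sigma> \<in> V \<and> infnorm (x - cell_center \<sigma>) < 1 / (2 * 3 ^ k)"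
    using grid_cell_infnorm_ball[OF assms] by blast
  show ?thesis
    unfolding V(3) using subspace_0[OF V(1)] by (simp add: infnorm_0)
qed

lemma infnorm_diff_grid_cell:
  fixes \<sigma> :: "(real ^ 'm) set"
  assumes "\<sigma> \<in> grid_cells k q" "x \<in> \<sigma>" "y \<in> \<sigma>"
  shows "infnorm (x - y) \<le> 1 / 3 ^ k"
proof -
  let ?c = "cell_center \<sigma>"
  have half: "1 / (2 * 3 ^ k) + 1 / (2 * 3 ^ k) = (1 / 3 ^ k :: real)"
    by (simp add: field_simps)
  obtain V where
    "\<And>x. x \<in> \<sigma> \<longleftrightarrow> x - cell_center \<sigma> \<in> V \<and> infnorm (x - cell_center \<sigma>) \<le> 1 / (2 * 3 ^ k)"
    using grid_cell_infnorm_ball[OF assms(1)] by metis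
  then have "infnorm (x - ?c) \<le> 1 / (2 * 3 ^ k)" "infnorm (y - ?c) \<le> 1 / (2 * 3 ^ k)"
    using assms(2,3) by blast+
  moreover have "infnorm (x - y) \<le> infnorm (x - ?c) + infnorm (y - ?c)"
    using infnorm_triangle[of "x - ?c" "?c - y"] infnorm_sub[of y ?c] by simp
  ultimately show ?thesis using half by linarith
qed

text \<open>The union need not be convex, so bounds on single cells do not simply add up along a
  segment. Either there is a common point to pass through, or the points are so far apart that the
  displacement by \<open>f\<close> is controlled by their distance.\<close>

lemma lipschitz_on_Union_grid_cells:
  fixes f :: "real ^ 'm \<Rightarrow> real ^ 'm"
  assumes S: "S \<subseteq> grid_cells k q"
    and lip: "\<And>\<sigma> x y. \<sigma> \<in> S \<Longrightarrow> x \<in> \<sigma> \<Longrightarrow> y \<in> \<sigma> \<Longrightarrow> norm (f x - f y) \<le> M * norm (x - y)"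
    and inv: "\<And>\<sigma> x. \<sigma> \<in> S \<Longrightarrow> x \<in> \<sigma> \<Longrightarrow> f x \<in> \<sigma>"
    and x: "x \<in> \<Union>S" and y: "y \<in> \<Union>S" and "0 \<le> M"
  shows "norm (f x - f y) \<le> (2 * M + 2 * sqrt CARD('m) + 1) * norm (x - y)"
proof -
  obtain \<sigma> where \<sigma>: "\<sigma> \<in> S" "\<sigma> \<in> grid_cells k q" "x \<in> \<sigma>" using x S by blast
  obtain \<tau> where \<tau>: "\<tau> \<in> S" "\<tau> \<in> grid_cells k q" "y \<in> \<tau>" using y S by blast
  let ?n = "norm (x - y)" and ?D = "sqrt CARD('m)"
  consider w where "w \<in> \<sigma> \<inter> \<tau>" "norm (x - w) \<le> ?n" "norm (w - y) \<le> ?n" | "1 / 3 ^ k \<le> ?n"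
    using grid_cells_meet_or_far[OF \<sigma>(2) \<tau>(2) \<sigma>(3) \<tau>(3)] by blast
  then show ?thesis
  proof cases
    case 1
    have "norm (f x - f y) \<le> norm (f x - f w) + norm (f w - f y)"
      using norm_triangle_ineq[of "f x - f w" "f w - f y"] by simp
    also have "\<dots> \<le> M * norm (x - w) + M * norm (w - y)"
      using 1 \<sigma> \<tau> by (intro add_mono lip) auto
    also have "\<dots> \<le> M * ?n + M * ?n"
      using 1 \<open>0 \<le> M\<close> by (intro add_mono mult_left_mono) auto
    also have "\<dots> = 2 * M * ?n" by simp
    also have "\<dots> \<le> (2 * M + 2 * ?D + 1) * ?n"
      by (intro mult_right_mono) auto
    finally show ?thesis .
  next
    case 2
    \<comment> \<open>Since \<open>f\<close> preserves every cell, it moves a point by at most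
      \<open>1 / 3 ^ k\<close> in the maximum norm. The square root passes to the Euclidean norm,
      and comparison with the distance of \<open>x\<close> and \<open>y\<close> removes the
      dependence on \<open>k\<close>.\<close>
    have diam: "norm (z - f z) \<le> ?D * ?n" if "z \<in> \<rho>" "\<rho> \<in> S" for z \<rho>
    proof -
      have "norm (z - f z) \<le> ?D * infnorm (z - f z)"
        using norm_le_infnorm[of "z - f z"] by simp
      also have "\<dots> \<le> ?D * (1 / 3 ^ k)"
        using infnorm_diff_grid_cell[of \<rho> k q z "f z"] that S inv by (intro mult_left_mono) auto
      also have "\<dots> \<le> ?D * ?n"
        using 2 by (intro mult_left_mono) auto
      finally show ?thesis .
    qed
    have "norm (f x - f y) \<le> norm (x - f x) + ?n + norm (y - f y)"
      using norm_triangle_ineq4[of "x - y" "x - f x"] norm_triangle_ineq[of "x - y - (x - f x)" "y - f y"]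
      by simp
    also have "\<dots> \<le> ?D * ?n + ?n + ?D * ?n"
      using diam \<sigma> \<tau> by (intro add_mono) auto
    also have "\<dots> = (2 * ?D + 1) * ?n" by (simp add: algebra_simps)
    also have "\<dots> \<le> (2 * M + 2 * ?D + 1) * ?n"
      using \<open>0 \<le> M\<close> by (intro mult_right_mono) auto
    finally show ?thesis .
  qed
qed

section \<open>Radial maps\<close>

text \<open>For a nonnegative radius this is the point at maximum-norm distance
  \<open>s * \<mu> x\<close> from \<open>c\<close> on the ray through \<open>x\<close>. For
  \<open>x = c\<close> the vector \<open>x - c\<close> vanishes, so the division by 0 is harmless
  and \<open>c\<close> is fixed whatever \<open>\<mu> c\<close> is.\<close>

definition radial :: "real \<Rightarrow> 'a::euclidean_space \<Rightarrow> ('a \<Rightarrow> real) \<Rightarrow> 'a \<Rightarrow> 'a" where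
  "radial s c \<mu> x = c + (s * \<mu> x / infnorm (x - c)) *\<^sub>R (x - c)"

lemma radial_center [simp]: "radial s c \<mu> c = c"
  by (simp add: radial_def)

lemma infnorm_radial:
  assumes "x \<noteq> c" "0 \<le> s * \<mu> x"
  shows "infnorm (radial s c \<mu> x - c) = s * \<mu> x"
proof -
  have "infnorm (x - c) > 0" using assms by (simp add: infnorm_pos_lt)
  then show ?thesis using assms(2) by (simp add: radial_def infnorm_mul)
qed

lemma norm_radial_le:
  fixes c :: "'a::euclidean_space"
  assumes "0 \<le> s" "0 \<le> \<mu> x" "\<mu> x \<le> P * norm (x - c)"
  shows "norm (radial s c \<mu> x - c) \<le> s * P * sqrt DIM('a) * norm (x - c)"
proof (cases "x = c")
  case False
  have N: "infnorm (x - c) > 0" using False by (simp add: infnorm_pos_lt)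
  have "norm (radial s c \<mu> x - c) = s * \<mu> x * (norm (x - c) / infnorm (x - c))"
    using assms(1,2) N by (simp add: radial_def)
  also have "\<dots> \<le> s * (P * norm (x - c)) * sqrt DIM('a)"
    using assms N norm_le_infnorm[of "x - c"]
    by (intro mult_mono) (auto simp: divide_le_eq intro: order_trans)
  finally show ?thesis by (simp add: ac_simps)
qed simp

text \<open>Inserting \<open>a / infnorm b\<close> between the two normalized vectors separates the
  change of the norm from the change of the vector. The factor \<open>sqrt DIM('a)\<close> compares
  the two norms.\<close>

lemma norm_infnorm_unit_diff_le:
  fixes a b :: "'a::euclidean_space"
  assumes "a \<noteq> 0" "b \<noteq> 0"
  shows "norm (a /\<^sub>R infnorm a - b /\<^sub>R infnorm b) \<le> (sqrt DIM('a) + 1) * norm (a - b) / infnorm b"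
proof -
  let ?D = "sqrt DIM('a)"
  have a: "infnorm a > 0" and b: "infnorm b > 0" using assms by (simp_all add: infnorm_pos_lt)
  have "a /\<^sub>R infnorm a - b /\<^sub>R infnorm b =
      ((infnorm b - infnorm a) / infnorm b) *\<^sub>R (a /\<^sub>R infnorm a) + (a - b) /\<^sub>R infnorm b"
  proof -
    have "(infnorm b - infnorm a) / infnorm b * inverse (infnorm a) = inverse (infnorm a) - inverse (infnorm b)"
      using a b by (simp add: field_simps)
    then show ?thesis by (simp add: scaleR_left_diff_distrib scaleR_right_diff_distrib)
  qed
  also have "norm \<dots> \<le> \<bar>infnorm b - infnorm a\<bar> / infnorm b * (norm a / infnorm a) + norm (a - b) / infnorm b"
    using a b by (intro order_trans[OF norm_triangle_ineq]) (simp add: divide_inverse abs_mult ac_simps)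
  also have "\<dots> \<le> norm (a - b) / infnorm b * ?D + norm (a - b) / infnorm b"
  proof -
    have "\<bar>infnorm b - infnorm a\<bar> \<le> norm (a - b)"
      using absdiff_infnorm[of b a] infnorm_le_norm[of "a - b"] infnorm_sub[of a b] by linarith
    moreover have "norm a / infnorm a \<le> ?D"
      using a norm_le_infnorm[of a] by (simp add: divide_le_eq)
    ultimately show ?thesis
      using a b by (intro add_mono mult_mono divide_right_mono) auto
  qed
  also have "\<dots> = (?D + 1) * norm (a - b) / infnorm b"
    by (simp add: add_divide_distrib distrib_right)
  finally show ?thesis .
qed

text \<open>The direction of \<open>x - c\<close> alone has a Lipschitz constant that blows up near
  \<open>c\<close>. Since \<mu> is Lipschitz and vanishes at \<open>c\<close>, the radius is at most
  proportional to the distance from \<open>c\<close>, which cancels the blow-up.\<close>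

lemma radial_lipschitz:
  fixes c :: "'a::euclidean_space"
  assumes lip: "\<And>x y. x \<in> S \<Longrightarrow> y \<in> S \<Longrightarrow> \<bar>\<mu> x - \<mu> y\<bar> \<le> P * norm (x - y)"
    and \<mu>: "\<And>x. x \<in> S \<Longrightarrow> 0 \<le> \<mu> x" "\<mu> c = 0"
    and S: "c \<in> S" "x \<in> S" "y \<in> S" and "0 \<le> s" "0 \<le> P"
  shows "norm (radial s c \<mu> x - radial s c \<mu> y) \<le>
    s * P * (sqrt DIM('a) * (sqrt DIM('a) + 2)) * norm (x - y)"
proof -
  let ?D = "sqrt DIM('a)"
  have \<mu>_le: "\<mu> x \<le> P * norm (x - c)" if "x \<in> S" for x
    using lip[OF that S(1)] \<mu> that by simp
  have D: "s * P * ?D * t \<le> s * P * (?D * (?D + 2)) * t" if "0 \<le> t" for t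
  proof -
    have "?D * 1 \<le> ?D * (?D + 2)" by (intro mult_left_mono) auto
    then show ?thesis using assms that by (intro mult_right_mono mult_left_mono) (auto simp: mult.assoc)
  qed
  have center: "norm (radial s c \<mu> z - c) \<le> s * P * (?D * (?D + 2)) * norm (z - c)" if "z \<in> S" for z
    using norm_radial_le[of s \<mu> z P c, OF \<open>0 \<le> s\<close> \<mu>(1)[OF that] \<mu>_le[OF that]] D[OF norm_ge_zero] by (rule order_trans)
  consider "x = c" | "y = c" | "x \<noteq> c" "y \<noteq> c" by blast
  then show ?thesis
  proof cases
    case 1
    then show ?thesis
      using center[OF S(3)] by (simp add: norm_minus_commute[of c])
  next
    case 2
    then show ?thesis
      using center[OF S(2)] by simp
  next
    case 3
    define a b where "a = x - c" and "b = y - c"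
    have ab: "a \<noteq> 0" "b \<noteq> 0" "a - b = x - y" using 3 by (simp_all add: a_def b_def)
    have N: "infnorm a > 0" "infnorm b > 0" using ab by (simp_all add: infnorm_pos_lt)
    \<comment> \<open>Product rule: a change of radius in a fixed direction plus a change of
      direction at a fixed radius.\<close>
    have "radial s c \<mu> x - radial s c \<mu> y =
        (s * (\<mu> x - \<mu> y)) *\<^sub>R (a /\<^sub>R infnorm a) + (s * \<mu> y) *\<^sub>R (a /\<^sub>R infnorm a - b /\<^sub>R infnorm b)"
    proof -
      have "radial s c \<mu> x = c + (s * \<mu> x) *\<^sub>R (a /\<^sub>R infnorm a)"
        "radial s c \<mu> y = c + (s * \<mu> y) *\<^sub>R (b /\<^sub>R infnorm b)"
        by (simp_all add: radial_def a_def b_def divide_inverse)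
      then show ?thesis
        by (simp only: right_diff_distrib scaleR_diff_left scaleR_diff_right) simp
    qed
    also have "norm \<dots> \<le> s * \<bar>\<mu> x - \<mu> y\<bar> * (norm a / infnorm a) +
        s * \<mu> y * norm (a /\<^sub>R infnorm a - b /\<^sub>R infnorm b)"
      using \<open>0 \<le> s\<close> \<mu>(1)[OF S(3)] N
      by (intro order_trans[OF norm_triangle_ineq]) (simp add: divide_inverse abs_mult ac_simps)
    also have "\<dots> \<le> s * (P * norm (x - y)) * ?D +
        s * (P * (?D * infnorm b)) * ((?D + 1) * norm (x - y) / infnorm b)"
    proof (intro add_mono mult_mono)
      show "norm a / infnorm a \<le> ?D"
        using N norm_le_infnorm[of a] by (simp add: divide_le_eq)
      show "\<mu> y \<le> P * (?D * infnorm b)"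
        using \<mu>_le[OF S(3)] norm_le_infnorm[of b] \<open>0 \<le> P\<close>
        by (auto simp: b_def intro: order_trans mult_left_mono)
      show "norm (a /\<^sub>R infnorm a - b /\<^sub>R infnorm b) \<le> (?D + 1) * norm (x - y) / infnorm b"
        using norm_infnorm_unit_diff_le[OF ab(1,2)] ab(3) by simp
    qed (use lip S N \<mu> \<open>0 \<le> s\<close> \<open>0 \<le> P\<close> in auto)
    also have "\<dots> = s * P * (?D * (?D + 2)) * norm (x - y)"
      using N by (simp add: field_simps)
    finally show ?thesis .
  qed
qed

context
  fixes \<sigma> :: "(real ^ 'm) set" and k q :: nat and \<mu> :: "real ^ 'm \<Rightarrow> real" and r
  assumes \<sigma>: "\<sigma> \<in> grid_cells k q"
  defines "r \<equiv> radial (1 / (2 * 3 ^ k)) (cell_center \<sigma>) \<mu>"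
begin

text \<open>As the scale is half an edge, \<mu> is the relative radius of the image: below 1 means
  inside, 1 means on the boundary. The third claim excludes the center because it stays fixed for
  any \<mu>. A boundary point already has relative radius 1, so it is scaled by 1.\<close>

lemma radial_grid_cell:
  assumes x: "x \<in> \<sigma>" and \<mu>: "0 \<le> \<mu> x" "\<mu> x \<le> 1"
  shows "r x \<in> \<sigma>"
    and "\<mu> x < 1 \<Longrightarrow> r x \<in> rel_interior \<sigma>"
    and "\<mu> x = 1 \<Longrightarrow> x \<noteq> cell_center \<sigma> \<Longrightarrow> r x \<notin> rel_interior \<sigma>"
    and "\<mu> x = 1 \<Longrightarrow> x \<notin> rel_interior \<sigma> \<Longrightarrow> r x = x"
proof -
  let ?c = "cell_center \<sigma>" and ?s = "1 / (2 * 3 ^ k) :: real"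
  obtain V where V: "subspace V"
    and mem: "\<And>x. x \<in> \<sigma> \<longleftrightarrow> x - ?c \<in> V \<and> infnorm (x - ?c) \<le> ?s"
    and int: "\<And>x. x \<in> rel_interior \<sigma> \<longleftrightarrow> x - ?c \<in> V \<and> infnorm (x - ?c) < ?s"
    using grid_cell_infnorm_ball[OF \<sigma>] by blast
  have "x - ?c \<in> V" using x unfolding mem by blast
  then have rV: "r x - ?c \<in> V"
    unfolding r_def radial_def using V by (simp add: subspace_scale)
  have norm: "infnorm (r x - ?c) = ?s * \<mu> x" if "x \<noteq> ?c"
    unfolding r_def using that \<mu> by (intro infnorm_radial mult_nonneg_nonneg) auto
  have center: "r ?c = ?c"
    by (simp add: r_def)
  have c: "?c \<in> rel_interior \<sigma>"
    by (rule cell_center_in_grid_cell[OF \<sigma>])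
  show "r x \<in> \<sigma>"
  proof (cases "x = ?c")
    case True
    then show ?thesis using center x by simp
  next
    case False
    have "?s * \<mu> x \<le> ?s" using \<mu>(2) by (simp add: field_simps)
    then show ?thesis unfolding mem using rV norm[OF False] by simp
  qed
  show "r x \<in> rel_interior \<sigma>" if "\<mu> x < 1"
  proof (cases "x = ?c")
    case True
    then show ?thesis using center c by simp
  next
    case False
    have "?s * \<mu> x < ?s" using that by (simp add: field_simps)
    then show ?thesis unfolding int using rV norm[OF False] by simp
  qed
  show "r x \<notin> rel_interior \<sigma>" if "\<mu> x = 1" "x \<noteq> ?c"
    unfolding int using norm that by simp
  show "r x = x" if "\<mu> x = 1" "x \<notin> rel_interior \<sigma>"
  proof -
    have "infnorm (x - ?c) = ?s"
      using that(2) x unfolding mem int by simp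
    then show ?thesis using that(1) by (simp add: r_def radial_def)
  qed
qed

end

section \<open>Orbits and isotropy groups of isometric actions\<close>

locale isometric_action = group_action G UNIV act
  for G :: "('g, 'x) monoid_scheme" (structure) and act :: "'g \<Rightarrow> 'a::metric_space \<Rightarrow> 'a" +
  assumes dist_act: "x \<in> carrier G \<Longrightarrow> dist (act x p) (act x q) = dist p q"
begin

sublocale group G
  using group_hom by (rule group_hom.axioms(1))

lemma act_mult: "x \<in> carrier G \<Longrightarrow> y \<in> carrier G \<Longrightarrow> act (x \<otimes> y) p = act x (act y p)"
  by (rule composition_rule) auto

lemma act_inv_act: "x \<in> carrier G \<Longrightarrow> act (inv x) (act x p) = p"
  using orbit_sym_aux by blast

lemma act_act_inv: "x \<in> carrier G \<Longrightarrow> act x (act (inv x) p) = p"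
  using act_inv_act[of "inv x"] by simp

lemma mem_orbit_iff: "q \<in> orbit G act p \<longleftrightarrow> (\<exists>x\<in>carrier G. q = act x p)"
  by (auto simp: orbit_def)

lemma orbit_act:
  assumes "x \<in> carrier G"
  shows "orbit G act (act x p) = orbit G act p"
proof (intro Set.set_eqI iffI)
  fix q assume "q \<in> orbit G act (act x p)"
  then show "q \<in> orbit G act p"
    using assms act_mult unfolding mem_orbit_iff by (metis m_closed)
next
  fix q assume "q \<in> orbit G act p"
  then obtain y where "y \<in> carrier G" "q = act y p" unfolding mem_orbit_iff by blast
  then have "q = act (y \<otimes> inv x) (act x p)" "y \<otimes> inv x \<in> carrier G"
    using assms by (simp_all add: act_mult act_inv_act)
  then show "q \<in> orbit G act (act x p)"
    unfolding mem_orbit_iff by blast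
qed

lemma orbit_eq_iff: "orbit G act p = orbit G act q \<longleftrightarrow> (\<exists>x\<in>carrier G. p = act x q)"
  using orbit_act mem_orbit_iff orbit_refl by (metis UNIV_I)

lemma self_in_orbit: "p \<in> orbit G act p"
  by (simp add: orbit_refl)

lemma orbits_eq: "orbits G UNIV act = range (orbit G act)"
  by (auto simp: orbits_def)

section \<open>Distances between orbits\<close>

lemma infdist_act_orbit:
  assumes "x \<in> carrier G"
  shows "infdist (act x p) (orbit G act q) \<le> infdist p (orbit G act q)"
proof -
  have ne: "orbit G act q \<noteq> {}" using self_in_orbit by blast
  have "infdist (act x p) (orbit G act q) \<le> dist p r" if "r \<in> orbit G act q" for r
  proof -
    have "act x r \<in> orbit G act q"
      using that assms orbit_act self_in_orbit by (metis mem_orbit_iff)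
    then have "infdist (act x p) (orbit G act q) \<le> dist (act x p) (act x r)"
      by (rule infdist_le)
    then show ?thesis using dist_act[OF assms] by simp
  qed
  then show ?thesis
    unfolding infdist_notempty[OF ne] using ne by (intro cINF_greatest) (auto simp: infdist_notempty[OF ne])
qed

lemma infdist_orbit_cong:
  assumes "orbit G act p = orbit G act p'"
  shows "infdist p (orbit G act q) = infdist p' (orbit G act q)"
  using assms infdist_act_orbit orbit_eq_iff by (metis antisym)

text \<open>All points of an orbit are equally far from another orbit, so the infimum over pairs
  reduces to an infimum over one point.\<close>

lemma setdist_orbit: "setdist (orbit G act p) (orbit G act q) = infdist p (orbit G act q)"
proof (rule antisym)
  show "setdist (orbit G act p) (orbit G act q) \<le> infdist p (orbit G act q)"
    unfolding infdist_eq_setdist by (rule setdist_subset_left) (auto simp: self_in_orbit)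
  show "infdist p (orbit G act q) \<le> setdist (orbit G act p) (orbit G act q)"
  proof (rule le_setdistI)
    show "orbit G act p \<noteq> {}" "orbit G act q \<noteq> {}" using self_in_orbit by blast+
    fix p' q' assume "p' \<in> orbit G act p" and q': "q' \<in> orbit G act q"
    then have "orbit G act p = orbit G act p'" using orbit_act unfolding mem_orbit_iff by metis
    then show "infdist p (orbit G act q) \<le> dist p' q'"
      using infdist_le[OF q'] infdist_orbit_cong by metis
  qed
qed

text \<open>The triangle inequality fails for \<open>setdist\<close> of general sets. For orbits it
  is \<open>infdist\<close> from any point of the first orbit, which is 1-Lipschitz in that
  point.\<close>

lemma setdist_orbit_diff_le:
  "\<bar>setdist (orbit G act p) (orbit G act r) - setdist (orbit G act q) (orbit G act r)\<bar>
    \<le> setdist (orbit G act p) (orbit G act q)"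
proof -
  have *: "setdist (orbit G act p) (orbit G act r) - setdist (orbit G act q) (orbit G act r)
      \<le> setdist (orbit G act p) (orbit G act q)" for p q
  proof (rule le_setdistI)
    show "orbit G act p \<noteq> {}" "orbit G act q \<noteq> {}" using self_in_orbit by blast+
    fix p' q' assume "p' \<in> orbit G act p" "q' \<in> orbit G act q"
    then have "orbit G act p = orbit G act p'" "orbit G act q = orbit G act q'"
      using orbit_act unfolding mem_orbit_iff by metis+
    then have "setdist (orbit G act p) (orbit G act r) = infdist p' (orbit G act r)"
      "setdist (orbit G act q) (orbit G act r) = infdist q' (orbit G act r)"
      by (simp_all add: setdist_orbit)
    then show "setdist (orbit G act p) (orbit G act r) - setdist (orbit G act q) (orbit G act r) \<le> dist p' q'"
      using infdist_triangle[of p' "orbit G act r" q'] by simp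
  qed
  show ?thesis using *[of p q] *[of q p] by (simp add: setdist_sym abs_le_iff)
qed

text \<open>Recurrence. The assumption spreads along the backward iterates \<open>a i\<close> of
  \<open>p\<close> under \<open>x\<close>: isotropy groups increase, so any \<open>k\<close> fixing
  \<open>p\<close> fixes all of them. By compactness the isometry brings \<open>p\<close> back
  arbitrarily close to itself, so some iterate is arbitrarily close to \<open>act x p\<close>; hence
  \<open>k\<close> fixes this point as well.\<close>

lemma stabilizer_act_superset:
  assumes "compact (UNIV :: 'a set)" "x \<in> carrier G"
    and sub: "stabilizer G act (act x p) \<subseteq> stabilizer G act p"
  shows "stabilizer G act p \<subseteq> stabilizer G act (act x p)"
proof
  fix k assume "k \<in> stabilizer G act p"
  then have k: "k \<in> carrier G" "act k p = p" by (auto simp: stabilizer_def)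
  let ?f = "act (inv x)"
  define a where "a i = (?f ^^ i) p" for i
  have a_Suc: "a (Suc i) = ?f (a i)" for i by (simp add: a_def)
  have f_dist: "dist (?f q) (?f r) = dist q r" for q r
    using dist_act assms(2) by simp
  have sub_a: "act h (a i) = a i" if "h \<in> carrier G" "act h (act x (a i)) = act x (a i)" for h i
    using that
  proof (induction i arbitrary: h)
    case 0
    then show ?case using sub by (auto simp: a_def stabilizer_def)
  next
    case (Suc i)
    have h: "act h (a i) = a i"
      using Suc.prems assms(2) by (simp add: a_Suc act_act_inv)
    \<comment> \<open>Conjugation by \<open>x\<close> moves the statement about
      \<open>a (Suc i)\<close> back to \<open>a i\<close>, where the induction hypothesis
      applies.\<close>
    define h' where "h' = x \<otimes> h \<otimes> inv x"
    have h': "h' \<in> carrier G" using Suc.prems assms(2) by (simp add: h'_def)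
    have h'_act: "act h' q = act x (act h (?f q))" for q
      using Suc.prems assms(2) by (simp add: h'_def act_mult)
    have "act h' (act x (a i)) = act x (a i)"
      unfolding h'_act using h assms(2) by (simp add: act_inv_act)
    then have "act h' (a i) = a i" using Suc.IH h' by blast
    then have "act x (act h (a (Suc i))) = a i" unfolding h'_act a_Suc .
    then show ?case using assms(2) by (metis a_Suc act_inv_act)
  qed
  have fix_a: "act k (a i) = a i" for i
  proof (induction i)
    case 0
    then show ?case using k by (simp add: a_def)
  next
    case (Suc i)
    then show ?case
      using sub_a[OF k(1), of "Suc i"] assms(2) by (simp add: a_Suc act_act_inv)
  qed
  have "dist (act k (act x p)) (act x p) \<le> e" if "0 < e" for e
  proof -
    \<comment> \<open>Two terms of a convergent subsequence are close, and as \<open>?f\<close> is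
      an isometry both can be shifted back until the first is \<open>p\<close>.\<close>
    obtain l r where "strict_mono (r :: nat \<Rightarrow> nat)" "(a \<circ> r) \<longlonglongrightarrow> l"
      using assms(1) unfolding compact_eq_seq_compact_metric seq_compact_def by (metis UNIV_I)
    then have "Cauchy (a \<circ> r)" by (meson LIMSEQ_imp_Cauchy)
    then obtain N where "\<forall>i\<ge>N. \<forall>j\<ge>N. dist ((a \<circ> r) i) ((a \<circ> r) j) < e / 2"
      using half_gt_zero[OF \<open>0 < e\<close>] unfolding Cauchy_def by blast
    then have N: "dist ((a \<circ> r) N) ((a \<circ> r) (Suc N)) < e / 2"
      using le_SucI[OF le_refl] le_refl by blast
    \<comment> \<open>The return time is positive, so one application of \<open>?f\<close> can be
      cancelled and \<open>act x p\<close> comes close to \<open>a m\<close>.\<close>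
    obtain m where m: "r (Suc N) = r N + Suc m"
      using \<open>strict_mono r\<close> by (metis less_iff_Suc_add lessI strict_mono_less add_Suc_right)
    have shift: "dist (a i) (a (i + j)) = dist p (a j)" for i j
      by (induction i) (simp_all add: a_Suc f_dist, simp add: a_def)
    have "dist p (a (Suc m)) < e / 2" using N m shift[of "r N" "Suc m"] by simp
    then have "dist (?f (act x p)) (?f (a m)) < e / 2"
      using assms(2) by (simp add: act_inv_act a_Suc)
    then have near: "dist (act x p) (a m) < e / 2" by (simp only: f_dist)
    have "dist (act k (act x p)) (act x p) \<le> dist (act k (act x p)) (act k (a m)) + dist (a m) (act x p)"
      using fix_a dist_triangle by metis
    also have "\<dots> < e / 2 + e / 2"
      using near dist_act[OF k(1)] by (simp add: dist_commute)
    finally show ?thesis by simp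
  qed
  then have "act k (act x p) = act x p"
    by (metis dist_eq_0_iff dense_ge zero_le_dist antisym)
  then show "k \<in> stabilizer G act (act x p)"
    using k by (simp add: stabilizer_def)
qed

text \<open>Principality puts a conjugate of the isotropy group of \<open>p\<close>, namely that of
  \<open>act x p\<close>, inside the one of \<open>q\<close> and hence inside that of
  \<open>p\<close>. By recurrence all these groups coincide.\<close>

lemma principal_stabilizer_eq:
  assumes "compact (UNIV :: 'a set)" and principal: "principal_orbit G act (orbit G act p)"
    and sub: "stabilizer G act q \<subseteq> stabilizer G act p"
  shows "stabilizer G act p = stabilizer G act q"
proof -
  obtain x where x: "x \<in> carrier G"
      "(\<lambda>h. x \<otimes> h \<otimes> inv x) ` stabilizer G act p \<subseteq> stabilizer G act q"
    using principal self_in_orbit unfolding principal_orbit_def by blast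
  have "stabilizer G act (act x p) \<subseteq> stabilizer G act q"
  proof
    fix h assume "h \<in> stabilizer G act (act x p)"
    then have h: "h \<in> carrier G" "act h (act x p) = act x p" by (auto simp: stabilizer_def)
    define h' where "h' = inv x \<otimes> h \<otimes> x"
    have "h' \<in> stabilizer G act p"
      using h x by (simp add: h'_def stabilizer_def act_mult act_inv_act)
    moreover have "x \<otimes> (inv x \<otimes> h) = h"
      using h x by (simp add: m_assoc[symmetric])
    then have "x \<otimes> h' \<otimes> inv x = h"
      using h x unfolding h'_def by (simp add: m_assoc)
    ultimately show "h \<in> stabilizer G act q" using x(2) by (metis image_subset_iff)
  qed
  then show ?thesis
    using stabilizer_act_superset[OF assms(1) x(1), of p] sub by blast
qed

end

section \<open>Equivariant lifts\<close>

text \<open>A homotopy \<open>\<phi>\<close> of the cells lifts to an equivariant homotopy along the sections \<open>u \<sigma>\<close> of the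
  orbit map: it is well defined because the isotropy groups do not shrink along \<open>\<phi>\<close>.\<close>

locale equivariant_lift = isometric_action G act
  for G :: "('g, 'x) monoid_scheme" (structure) and act :: "'g \<Rightarrow> 'a::metric_space \<Rightarrow> 'a" +
  fixes T :: "'g topology" and S :: "'k::metric_space set set" and u :: "'k set \<Rightarrow> 'k \<Rightarrow> 'a"
    and \<phi> :: "real \<Rightarrow> 'k \<Rightarrow> 'k"
  assumes compact_T: "compact_space T" and topspace_T: "topspace T = carrier G"
    and continuous_act: "continuous_map (prod_topology T euclidean) euclidean (\<lambda>(x, p). act x p)"
    and finite_S: "finite S" and compact_cell: "\<sigma> \<in> S \<Longrightarrow> compact \<sigma>"
    and continuous_u: "\<sigma> \<in> S \<Longrightarrow> continuous_on \<sigma> (u \<sigma>)"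
    and u_cover: "\<exists>\<sigma>\<in>S. \<exists>x\<in>\<sigma>. \<exists>g\<in>carrier G. p = act g (u \<sigma> x)"
    and u_inj: "\<sigma> \<in> S \<Longrightarrow> \<tau> \<in> S \<Longrightarrow> x \<in> \<sigma> \<Longrightarrow> y \<in> \<tau> \<Longrightarrow>
      orbit G act (u \<sigma> x) = orbit G act (u \<tau> y) \<Longrightarrow> x = y"
    and continuous_\<phi>: "\<sigma> \<in> S \<Longrightarrow> continuous_on ({0..1} \<times> \<sigma>) (\<lambda>(t, x). \<phi> t x)"
    and \<phi>_mem: "\<sigma> \<in> S \<Longrightarrow> x \<in> \<sigma> \<Longrightarrow> t \<in> {0..1} \<Longrightarrow> \<phi> t x \<in> \<sigma>"
    and \<phi>_overlap: "\<sigma> \<in> S \<Longrightarrow> \<tau> \<in> S \<Longrightarrow> \<sigma> \<noteq> \<tau> \<Longrightarrow> x \<in> \<sigma> \<Longrightarrow> x \<in> \<tau> \<Longrightarrow> t \<in> {0..1} \<Longrightarrow> \<phi> t x = x"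
    and stabilizer_\<phi>: "\<sigma> \<in> S \<Longrightarrow> x \<in> \<sigma> \<Longrightarrow> t \<in> {0..1} \<Longrightarrow>
      stabilizer G act (u \<sigma> x) \<subseteq> stabilizer G act (u \<sigma> (\<phi> t x))"
begin

text \<open>A choice among the values obtained by writing \<open>p\<close> as a translate of a point
  of a section; \<open>lifted_act\<close> shows that for times in the unit interval only one value
  occurs.\<close>

definition lifted :: "real \<Rightarrow> 'a \<Rightarrow> 'a" where
  "lifted t p = (SOME q. \<exists>\<sigma>\<in>S. \<exists>x\<in>\<sigma>. \<exists>g\<in>carrier G. p = act g (u \<sigma> x) \<and> q = act g (u \<sigma> (\<phi> t x)))"

text \<open>Two representations of a point share \<open>x\<close>. In the same cell the group
  elements differ by an isotropy element, which still fixes the section at the image under \<phi>;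
  for different cells \<phi> does not move \<open>x\<close>.\<close>

lemma lifted_act:
  assumes \<sigma>: "\<sigma> \<in> S" "x \<in> \<sigma>" and g: "g \<in> carrier G" and t: "t \<in> {0..1}"
  shows "lifted t (act g (u \<sigma> x)) = act g (u \<sigma> (\<phi> t x))"
  unfolding lifted_def
proof (rule some_equality)
  show "\<exists>\<tau>\<in>S. \<exists>y\<in>\<tau>. \<exists>h\<in>carrier G. act g (u \<sigma> x) = act h (u \<tau> y) \<and> act g (u \<sigma> (\<phi> t x)) = act h (u \<tau> (\<phi> t y))"
    using \<sigma> g by blast
next
  fix q assume "\<exists>\<tau>\<in>S. \<exists>y\<in>\<tau>. \<exists>h\<in>carrier G. act g (u \<sigma> x) = act h (u \<tau> y) \<and> q = act h (u \<tau> (\<phi> t y))"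
  then obtain \<tau> y h where \<tau>: "\<tau> \<in> S" "y \<in> \<tau>" and h: "h \<in> carrier G"
      and eq: "act g (u \<sigma> x) = act h (u \<tau> y)" and q: "q = act h (u \<tau> (\<phi> t y))"
    by blast
  have "orbit G act (u \<sigma> x) = orbit G act (u \<tau> y)"
    using orbit_act[OF g, of "u \<sigma> x"] orbit_act[OF h, of "u \<tau> y"] eq by simp
  then have xy: "x = y" using u_inj \<sigma> \<tau> by blast
  show "q = act g (u \<sigma> (\<phi> t x))"
  proof (cases "\<sigma> = \<tau>")
    case True
    have "inv g \<otimes> h \<in> stabilizer G act (u \<sigma> x)"
      using g h eq True xy by (simp add: stabilizer_def act_mult) (metis act_inv_act)
    then have "inv g \<otimes> h \<in> stabilizer G act (u \<sigma> (\<phi> t x))"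
      using stabilizer_\<phi>[OF \<sigma> t] by blast
    then have "act (inv g) (act h (u \<sigma> (\<phi> t x))) = u \<sigma> (\<phi> t x)"
      using g h by (simp add: stabilizer_def act_mult)
    then have "act h (u \<sigma> (\<phi> t x)) = act g (u \<sigma> (\<phi> t x))"
      using act_act_inv[OF g, of "act h (u \<sigma> (\<phi> t x))"] by simp
    then show ?thesis using q True xy by simp
  next
    case False
    then have "\<phi> t x = x" using \<phi>_overlap \<sigma> \<tau> t xy by blast
    then show ?thesis using q xy eq by simp
  qed
qed

lemma equivariant_lifted:
  assumes "t \<in> {0..1}"
  shows "equivariant G act (lifted t)"
  unfolding equivariant_def
proof (intro ballI allI)
  fix h p assume h: "h \<in> carrier G"
  obtain \<sigma> x g where \<sigma>: "\<sigma> \<in> S" "x \<in> \<sigma>" "g \<in> carrier G" "p = act g (u \<sigma> x)"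
    using u_cover by blast
  then have "lifted t (act h p) = lifted t (act (h \<otimes> g) (u \<sigma> x))"
    using h by (simp add: act_mult)
  also have "\<dots> = act (h \<otimes> g) (u \<sigma> (\<phi> t x))"
    using \<sigma> h assms by (intro lifted_act) auto
  also have "\<dots> = act h (lifted t p)"
    using \<sigma> h assms by (simp add: act_mult lifted_act)
  finally show "lifted t (act h p) = act h (lifted t p)" .
qed

lemma orbit_lifted:
  assumes "\<sigma> \<in> S" "x \<in> \<sigma>" "t \<in> {0..1}" "orbit G act p = orbit G act (u \<sigma> x)"
  shows "orbit G act (lifted t p) = orbit G act (u \<sigma> (\<phi> t x))"
  using assms orbit_eq_iff lifted_act orbit_act by metis

lemma lifted_eq_self:
  assumes "\<sigma> \<in> S" "x \<in> \<sigma>" "t \<in> {0..1}" "orbit G act p = orbit G act (u \<sigma> x)" "\<phi> t x = x"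
  shows "lifted t p = p"
  using assms orbit_eq_iff lifted_act by metis

text \<open>Over each cell the lift becomes an explicit formula on the product of time, group and
  cell. This product is compact and maps continuously onto a Hausdorff space, hence by a quotient
  map, through which continuity descends. Finitely many closed pieces then glue.\<close>

lemma continuous_lifted: "continuous_on ({0..1} \<times> UNIV) (\<lambda>(t, p). lifted t p)"
proof -
  define P where "P \<sigma> = {act g (u \<sigma> x) | g x. g \<in> carrier G \<and> x \<in> \<sigma>}" for \<sigma>
  let ?I = "top_of_set {0..1 :: real}"
  have main: "closed ({0..1::real} \<times> P \<sigma>) \<and> continuous_on ({0..1} \<times> P \<sigma>) (\<lambda>(t, p). lifted t p)"
    if \<sigma>: "\<sigma> \<in> S" for \<sigma>
  proof -
    define X where "X = prod_topology ?I (prod_topology T (top_of_set \<sigma>))"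
    have top_X: "topspace X = {0..1} \<times> carrier G \<times> \<sigma>"
      by (simp add: X_def topspace_T)
    have "compact_space X"
      unfolding X_def using compact_T compact_cell[OF \<sigma>]
      by (simp add: compact_space_prod_topology compact_space_subtopology)
    have fst_I: "continuous_map X ?I fst"
      unfolding X_def by (rule continuous_map_fst)
    then have fst_X: "continuous_map X euclidean fst"
      by (rule continuous_map_into_fulltopology)
    have g_X: "continuous_map X T (\<lambda>z. fst (snd z))"
      unfolding X_def
      using continuous_map_compose[OF continuous_map_snd continuous_map_fst] by (simp add: o_def)
    have x_X: "continuous_map X (top_of_set \<sigma>) (\<lambda>z. snd (snd z))"
      unfolding X_def
      using continuous_map_compose[OF continuous_map_snd continuous_map_snd] by (simp add: o_def)
    have act_X: "continuous_map X euclidean (\<lambda>z. act (fst (snd z)) (f z))"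
      if "continuous_map X euclidean f" for f
    proof -
      have "continuous_map X (prod_topology T euclidean) (\<lambda>z. (fst (snd z), f z))"
        using g_X that by (simp add: continuous_map_paired)
      from continuous_map_compose[OF this continuous_act] show ?thesis by (simp add: o_def)
    qed
    have u_cont: "continuous_map (top_of_set \<sigma>) euclidean (u \<sigma>)"
      using continuous_u[OF \<sigma>] by simp
    have "continuous_map X euclidean (\<lambda>z. u \<sigma> (snd (snd z)))"
      using continuous_map_compose[OF x_X u_cont] by (simp add: o_def)
    from act_X[OF this] have "continuous_map X euclidean (\<lambda>z. (fst z, act (fst (snd z)) (u \<sigma> (snd (snd z)))))"
      using fst_X by (simp add: continuous_map_paired flip: prod_topology_euclidean)
    moreover define \<Psi> where "\<Psi> = (\<lambda>z :: real \<times> 'g \<times> 'k. (fst z, act (fst (snd z)) (u \<sigma> (snd (snd z)))))"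
    ultimately have \<Psi>: "continuous_map X euclidean \<Psi>" by simp
    have img: "\<Psi> ` topspace X = {0..1} \<times> P \<sigma>"
    proof (intro Set.set_eqI iffI)
      fix w assume "w \<in> {0..1::real} \<times> P \<sigma>"
      then obtain t g x where "w = (t, act g (u \<sigma> x))" "t \<in> {0..1}" "g \<in> carrier G" "x \<in> \<sigma>"
        unfolding P_def by blast
      then show "w \<in> \<Psi> ` topspace X"
        unfolding top_X \<Psi>_def by (intro image_eqI[of _ _ "(t, g, x)"]) auto
    next
      fix w assume "w \<in> \<Psi> ` topspace X"
      then show "w \<in> {0..1} \<times> P \<sigma>"
        unfolding top_X \<Psi>_def P_def by auto blast
    qed
    have "compactin euclidean (\<Psi> ` topspace X)"
      using \<Psi> \<open>compact_space X\<close> image_compactin compact_space_def by blast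
    then have closed: "closed ({0..1::real} \<times> P \<sigma>)"
      unfolding img by (simp add: compact_imp_closed)
    have \<Psi>': "continuous_map X (top_of_set ({0..1} \<times> P \<sigma>)) \<Psi>"
      using \<Psi> img by (auto simp: continuous_map_in_subtopology)
    have "quotient_map X (top_of_set ({0..1} \<times> P \<sigma>)) \<Psi>"
    proof (rule continuous_closed_imp_quotient_map[OF \<Psi>'])
      show "closed_map X (top_of_set ({0..1} \<times> P \<sigma>)) \<Psi>"
        using \<open>compact_space X\<close> \<Psi>' by (intro continuous_imp_closed_map_gen Hausdorff_imp_kc_space)
          (auto intro: Hausdorff_space_subtopology)
      show "\<Psi> ` topspace X = topspace (top_of_set ({0..1} \<times> P \<sigma>))"
        using img by simp
    qed
    moreover have "continuous_map X euclidean ((\<lambda>(t, p). lifted t p) \<circ> \<Psi>)"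
    proof (rule continuous_map_eq)
      have "continuous_map X (prod_topology ?I (top_of_set \<sigma>)) (\<lambda>z. (fst z, snd (snd z)))"
        unfolding continuous_map_paired using fst_I x_X by blast
      moreover have "continuous_map (prod_topology ?I (top_of_set \<sigma>)) (top_of_set \<sigma>) (\<lambda>(t, x). \<phi> t x)"
        using continuous_\<phi>[OF \<sigma>] \<phi>_mem[OF \<sigma>]
        by (auto simp: prod_topology_subtopology_eu continuous_map_in_subtopology)
      ultimately have "continuous_map X (top_of_set \<sigma>) ((\<lambda>(t, x). \<phi> t x) \<circ> (\<lambda>z. (fst z, snd (snd z))))"
        by (rule continuous_map_compose)
      from continuous_map_compose[OF this u_cont]
      have "continuous_map X euclidean (\<lambda>z. u \<sigma> (\<phi> (fst z) (snd (snd z))))"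
        by (simp add: o_def)
      from act_X[OF this]
      show "continuous_map X euclidean (\<lambda>z. act (fst (snd z)) (u \<sigma> (\<phi> (fst z) (snd (snd z)))))" .
      show "act (fst (snd z)) (u \<sigma> (\<phi> (fst z) (snd (snd z)))) = ((\<lambda>(t, p). lifted t p) \<circ> \<Psi>) z"
        if "z \<in> topspace X" for z
        using that lifted_act[OF \<sigma>, of "snd (snd z)" "fst (snd z)" "fst z"] unfolding top_X \<Psi>_def by auto
    qed
    ultimately have "continuous_map (top_of_set ({0..1} \<times> P \<sigma>)) euclidean (\<lambda>(t, p). lifted t p)"
      by (rule continuous_compose_quotient_map)
    then show ?thesis using closed by simp
  qed
  have "p \<in> (\<Union>\<sigma>\<in>S. P \<sigma>)" for p
  proof -
    obtain \<sigma> x g where "\<sigma> \<in> S" "x \<in> \<sigma>" "g \<in> carrier G" "p = act g (u \<sigma> x)"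
      using u_cover by blast
    then show ?thesis unfolding P_def by blast
  qed
  then have "(\<Union>\<sigma>\<in>S. {0..1::real} \<times> P \<sigma>) = {0..1} \<times> UNIV"
    by blast
  moreover have "continuous_on (\<Union>\<sigma>\<in>S. {0..1} \<times> P \<sigma>) (\<lambda>(t, p). lifted t p)"
    by (rule continuous_on_closed_Union[OF finite_S]) (use main in blast)+
  ultimately show ?thesis by simp
qed

lemma homotopic_lifted:
  assumes \<phi>_0: "\<And>\<sigma> x. \<sigma> \<in> S \<Longrightarrow> x \<in> \<sigma> \<Longrightarrow> \<phi> 0 x = x"
    and fixed: "\<And>p t. p \<in> Z \<Longrightarrow> t \<in> {0..1} \<Longrightarrow> lifted t p = p"
  shows "homotopic_with_canon (\<lambda>h. equivariant G act h \<and> (\<forall>p\<in>Z. h p = p)) UNIV UNIV id (lifted 1)"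
proof -
  have "continuous_map (prod_topology (top_of_set {0..1}) (top_of_set UNIV)) (top_of_set UNIV) (\<lambda>(t, p). lifted t p)"
    unfolding prod_topology_subtopology_eu using continuous_lifted by simp
  moreover have "lifted 0 p = p" for p
    using u_cover[of p] \<phi>_0 lifted_act by fastforce
  ultimately show ?thesis
    unfolding homotopic_with_def using equivariant_lifted fixed
    by (intro exI[of _ "\<lambda>(t, p). lifted t p"]) auto
qed

end

section \<open>Expanding the tubes around the center orbits\<close>

text \<open>One level \<open>k\<close> and one radius \<epsilon> are fixed, whereas the bi-Lipschitz
  constant \<open>L\<close> belongs to \<open>F1\<close> alone; bounds in terms of \<open>L\<close>
  and \<open>CARD('m)\<close> are thus uniform. The condition \<open>1 \<le> l\<close> keeps
  \<open>l - 1\<close> from truncating.\<close>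

locale cubical_orbit_space = isometric_action G act
  for G :: "('g, 'x) monoid_scheme" (structure) and act :: "'g \<Rightarrow> 'a::metric_space \<Rightarrow> 'a" +
  fixes T :: "'g topology" and l :: nat and K :: "(real ^ 'm) set set" and F1 :: "real ^ 'm \<Rightarrow> 'a set"
    and L :: real and k :: nat and \<epsilon> :: real
  assumes compact_UNIV: "compact (UNIV :: 'a set)"
    and compact_T: "compact_space T" and topspace_T: "topspace T = carrier G"
    and continuous_act: "continuous_map (prod_topology T euclidean) euclidean (\<lambda>(x, p). act x p)"
    and l: "1 \<le> l"
    and adapted: "adapted_cubical_structure G act l K F1"
    and L: "0 < L"
    and F1_lipschitz: "x \<in> \<Union>K \<Longrightarrow> y \<in> \<Union>K \<Longrightarrow> setdist (F1 x) (F1 y) \<le> L * norm (x - y)"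
    and F1_expanding: "x \<in> \<Union>K \<Longrightarrow> y \<in> \<Union>K \<Longrightarrow> norm (x - y) \<le> L * setdist (F1 x) (F1 y)"
    and \<epsilon>: "0 < \<epsilon>" "\<epsilon> \<le> 1 / (2 * L)"
begin

section \<open>Cells of the subdivision and the orbits over them\<close>

abbreviation cells :: "(real ^ 'm) set set" where
  "cells \<equiv> subdiv_cells K k l"

lemma cubical: "cubical_subcomplex l K"
  using adapted by (simp add: adapted_cubical_structure_def)

lemma cells_grid: "\<sigma> \<in> cells \<Longrightarrow> \<sigma> \<in> grid_cells k l"
  by (simp add: subdiv_cells_def)

lemma Union_cells: "\<Union>cells = \<Union>K"
  by (rule Union_subdiv_cells[OF cubical])

lemma cell_subset: "\<sigma> \<in> cells \<Longrightarrow> \<sigma> \<subseteq> \<Union>K"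
  using Union_cells by blast

lemma F1_bij: "bij_betw F1 (\<Union>K) (orbits G UNIV act)"
  using adapted by (simp add: adapted_cubical_structure_def bilipschitz_homeo_def)

lemma F1_inj: "x \<in> \<Union>K \<Longrightarrow> y \<in> \<Union>K \<Longrightarrow> F1 x = F1 y \<Longrightarrow> x = y"
  using bij_betw_imp_inj_on[OF F1_bij] by (rule inj_onD)

lemma F1_eq_orbit:
  assumes "x \<in> \<Union>K"
  obtains p where "F1 x = orbit G act p"
proof -
  have "F1 x \<in> range (orbit G act)"
    using bij_betwE[OF F1_bij] assms unfolding orbits_eq by (rule bspec)
  then show thesis using that by blast
qed

lemma orbit_eq_F1: "\<exists>\<sigma>\<in>cells. \<exists>x\<in>\<sigma>. orbit G act p = F1 x"
proof -
  have "orbit G act p \<in> F1 ` \<Union>K"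
    using bij_betw_imp_surj_on[OF F1_bij] unfolding orbits_eq by blast
  then show ?thesis unfolding Union_cells[symmetric] by blast
qed

lemma mem_lift: "p \<in> lift G act F1 Z \<longleftrightarrow> (\<exists>x\<in>Z. orbit G act p = F1 x)"
  by (auto simp: lift_def)

lemma center_mem: "\<sigma> \<in> cells \<Longrightarrow> cell_center \<sigma> \<in> \<sigma>"
  using cell_center_in_grid_cell[OF cells_grid] rel_interior_subset by blast

lemma setdist_F1:
  assumes "x \<in> \<Union>K" "y \<in> \<Union>K" "orbit G act p = F1 x"
  shows "setdist (F1 x) (F1 y) = infdist p (F1 y)"
proof -
  obtain q where "F1 y = orbit G act q" using F1_eq_orbit assms(2) by blast
  then show ?thesis using setdist_orbit[of p q] assms(3) by simp
qed

text \<open>A section of the orbit map over \<sigma>, read through \<open>F1\<close>. The choices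
  for different cells are independent and need not agree on common faces.\<close>

definition cell_section :: "(real ^ 'm) set \<Rightarrow> real ^ 'm \<Rightarrow> 'a" where
  "cell_section \<sigma> = (SOME u. continuous_on \<sigma> u \<and> (\<forall>x\<in>\<sigma>. orbit G act (u x) = F1 x) \<and>
     (\<forall>x\<in>\<sigma>. stabilizer G act (u (cell_center \<sigma>)) \<subseteq> stabilizer G act (u x)))"

text \<open>The inverse of the orbit map on \<open>\<Omega>\<close>, composed with
  \<open>F1\<close>, is such a section: it is Lipschitz with constant \<open>L' * L\<close>, and the
  choice of \<open>\<Omega>\<close> controls its isotropy groups.\<close>

lemma cell_section:
  assumes \<sigma>: "\<sigma> \<in> cells"
  shows "continuous_on \<sigma> (cell_section \<sigma>)"
    and "\<And>x. x \<in> \<sigma> \<Longrightarrow> orbit G act (cell_section \<sigma> x) = F1 x"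
    and "\<And>x. x \<in> \<sigma> \<Longrightarrow> stabilizer G act (cell_section \<sigma> (cell_center \<sigma>)) \<subseteq> stabilizer G act (cell_section \<sigma> x)"
proof -
  obtain \<Omega> where \<Omega>: "\<Omega> \<subseteq> lift G act F1 \<sigma>"
    and bilip: "bilipschitz_homeo \<Omega> dist (orbit G act ` lift G act F1 \<sigma>) setdist (orbit G act)"
    and stab: "\<forall>p\<in>\<Omega>. stabilizer G act (inv_into \<Omega> (orbit G act) (F1 (cell_center \<sigma>))) \<subseteq> stabilizer G act p"
    using adapted \<sigma> unfolding adapted_cubical_structure_def by blast
  obtain L' where "L' > 0" and L': "\<And>p q. p \<in> \<Omega> \<Longrightarrow> q \<in> \<Omega> \<Longrightarrow> dist p q \<le> L' * setdist (orbit G act p) (orbit G act q)"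
    using bilip unfolding bilipschitz_homeo_def by blast
  have bij: "bij_betw (orbit G act) \<Omega> (orbit G act ` lift G act F1 \<sigma>)"
    using bilip unfolding bilipschitz_homeo_def by blast
  define u where "u x = inv_into \<Omega> (orbit G act) (F1 x)" for x
  have F1_mem: "F1 x \<in> orbit G act ` \<Omega>" if "x \<in> \<sigma>" for x
  proof -
    have "x \<in> \<Union>K" using that cell_subset[OF \<sigma>] by blast
    then obtain p where "F1 x = orbit G act p" by (rule F1_eq_orbit)
    moreover from this have "p \<in> lift G act F1 \<sigma>" unfolding mem_lift using that by metis
    ultimately have "F1 x \<in> orbit G act ` lift G act F1 \<sigma>" by simp
    then show ?thesis using bij_betw_imp_surj_on[OF bij] by simp
  qed
  have u: "u x \<in> \<Omega>" "orbit G act (u x) = F1 x" if "x \<in> \<sigma>" for x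
    unfolding u_def by (rule inv_into_into[OF F1_mem[OF that]] f_inv_into_f[OF F1_mem[OF that]])+
  have "(L' * L)-lipschitz_on \<sigma> u"
  proof (rule lipschitz_onI)
    fix x y assume xy: "x \<in> \<sigma>" "y \<in> \<sigma>"
    then have "x \<in> \<Union>K" "y \<in> \<Union>K" using cell_subset[OF \<sigma>] by blast+
    then have lip: "setdist (F1 x) (F1 y) \<le> L * norm (x - y)" by (rule F1_lipschitz)
    have "dist (u x) (u y) \<le> L' * setdist (F1 x) (F1 y)"
      using L'[of "u x" "u y"] u xy by simp
    also have "\<dots> \<le> L' * (L * norm (x - y))"
      using lip \<open>L' > 0\<close> by (intro mult_left_mono) auto
    finally show "dist (u x) (u y) \<le> L' * L * dist x y" by (simp add: dist_norm)
  qed (use L \<open>L' > 0\<close> in simp)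
  then have "continuous_on \<sigma> u" by (rule lipschitz_on_continuous_on)
  moreover have "\<forall>x\<in>\<sigma>. stabilizer G act (u (cell_center \<sigma>)) \<subseteq> stabilizer G act (u x)"
    using stab u(1) unfolding u_def by blast
  ultimately have "\<exists>u. continuous_on \<sigma> u \<and> (\<forall>x\<in>\<sigma>. orbit G act (u x) = F1 x) \<and>
      (\<forall>x\<in>\<sigma>. stabilizer G act (u (cell_center \<sigma>)) \<subseteq> stabilizer G act (u x))"
    using u(2) by blast
  from someI_ex[OF this, folded cell_section_def]
  show "continuous_on \<sigma> (cell_section \<sigma>)"
    "\<And>x. x \<in> \<sigma> \<Longrightarrow> orbit G act (cell_section \<sigma> x) = F1 x"
    "\<And>x. x \<in> \<sigma> \<Longrightarrow> stabilizer G act (cell_section \<sigma> (cell_center \<sigma>)) \<subseteq> stabilizer G act (cell_section \<sigma> x)"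
    by blast+
qed

text \<open>The orbit over \<open>x\<close> is principal, so the isotropy group there equals that at
  the center, which fixes the whole section.\<close>

lemma stabilizer_cell_section:
  assumes \<sigma>: "\<sigma> \<in> cells" and x: "x \<in> rel_interior \<sigma>" and y: "y \<in> \<sigma>"
  shows "stabilizer G act (cell_section \<sigma> x) \<subseteq> stabilizer G act (cell_section \<sigma> y)"
proof -
  have x': "x \<in> \<sigma>" using x rel_interior_subset by blast
  have "principal_orbit G act (F1 x)"
    using adapted \<sigma> x unfolding adapted_cubical_structure_def by blast
  then have "principal_orbit G act (orbit G act (cell_section \<sigma> x))"
    using cell_section(2)[OF \<sigma> x'] by simp
  then have "stabilizer G act (cell_section \<sigma> x) = stabilizer G act (cell_section \<sigma> (cell_center \<sigma>))"
    by (rule principal_stabilizer_eq[OF compact_UNIV _ cell_section(3)[OF \<sigma> x']])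
  then show ?thesis
    using cell_section(3)[OF \<sigma> y] by simp
qed

text \<open>The radial coordinate of the image is the distance in the orbit space to the center orbit, cut
  off at the radius of the tube. Hence the tube is mapped precisely onto the open cell.\<close>

definition tube_coord :: "(real ^ 'm) set \<Rightarrow> real ^ 'm \<Rightarrow> real" where
  "tube_coord \<sigma> x = min 1 (setdist (F1 x) (F1 (cell_center \<sigma>)) / (\<epsilon> * (1 / 3 ^ k)))"

definition cell_map :: "(real ^ 'm) set \<Rightarrow> real ^ 'm \<Rightarrow> real ^ 'm" where
  "cell_map \<sigma> = radial (1 / (2 * 3 ^ k)) (cell_center \<sigma>) (tube_coord \<sigma>)"

text \<open>Several cells are available only at points of common faces, where every cell map is the
  identity; so the choice does not matter.\<close>

definition complex_map :: "real ^ 'm \<Rightarrow> real ^ 'm" where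
  "complex_map x = cell_map (SOME \<sigma>. \<sigma> \<in> cells \<and> x \<in> \<sigma>) x"

section \<open>The radial expansion of a single cell\<close>

lemma tube_radius_pos: "0 < \<epsilon> * (1 / 3 ^ k)"
  using \<epsilon> by simp

lemma tube_coord_nonneg: "0 \<le> tube_coord \<sigma> x"
  using tube_radius_pos unfolding tube_coord_def
  by (intro min.boundedI divide_nonneg_pos setdist_pos_le) auto

lemma tube_coord_le_1: "tube_coord \<sigma> x \<le> 1"
  by (simp add: tube_coord_def)

lemma tube_coord_less_1_iff:
  "tube_coord \<sigma> x < 1 \<longleftrightarrow> setdist (F1 x) (F1 (cell_center \<sigma>)) < \<epsilon> * (1 / 3 ^ k)"
  by (simp only: tube_coord_def min_less_iff_disj pos_divide_less_eq[OF tube_radius_pos] mult_1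
      less_irrefl simp_thms)

lemma tube_coord_center:
  assumes "\<sigma> \<in> cells"
  shows "tube_coord \<sigma> (cell_center \<sigma>) = 0"
proof -
  have "cell_center \<sigma> \<in> \<Union>K" using center_mem cell_subset assms by blast
  then have "setdist (F1 (cell_center \<sigma>)) (F1 (cell_center \<sigma>)) \<le> L * norm (cell_center \<sigma> - cell_center \<sigma>)"
    by (intro F1_lipschitz)
  then have "setdist (F1 (cell_center \<sigma>)) (F1 (cell_center \<sigma>)) = 0"
    using setdist_pos_le by (simp add: antisym)
  then show ?thesis by (simp add: tube_coord_def)
qed

text \<open>The upper bound on \<epsilon> enters here: it makes \<open>L\<close> times the radius of
  the tube at most half an edge. As the point may lie anywhere in the complex,
  \<open>grid_cell_eqI\<close> then confines the tube to the cell of its center.\<close>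

lemma tube_in_cell:
  assumes "\<sigma> \<in> cells" "x \<in> \<Union>K" "tube_coord \<sigma> x < 1"
  shows "infnorm (x - cell_center \<sigma>) < 1 / (2 * 3 ^ k)"
proof -
  have c: "cell_center \<sigma> \<in> \<Union>K" using center_mem cell_subset assms by blast
  have "infnorm (x - cell_center \<sigma>) \<le> norm (x - cell_center \<sigma>)" by (rule infnorm_le_norm)
  also have "\<dots> \<le> L * setdist (F1 x) (F1 (cell_center \<sigma>))" by (rule F1_expanding[OF assms(2) c])
  also have "\<dots> < L * (\<epsilon> * (1 / 3 ^ k))"
    using assms(3) L unfolding tube_coord_less_1_iff by (rule mult_strict_left_mono)
  also have "\<dots> \<le> L * (1 / (2 * L) * (1 / 3 ^ k))"
    using L \<epsilon> by (intro mult_left_mono mult_right_mono) auto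
  also have "\<dots> = 1 / (2 * 3 ^ k)" using L by simp
  finally show ?thesis .
qed

text \<open>Boundary points are half an edge away from the center in the maximum norm, hence outside
  the tube. This makes the cell maps agree on common faces.\<close>

lemma tube_coord_boundary:
  assumes "\<sigma> \<in> cells" "x \<in> \<sigma>" "x \<notin> rel_interior \<sigma>"
  shows "tube_coord \<sigma> x = 1"
proof (rule ccontr)
  assume "tube_coord \<sigma> x \<noteq> 1"
  then have "tube_coord \<sigma> x < 1" using tube_coord_le_1[of \<sigma> x] by linarith
  moreover have "x \<in> \<Union>K" using assms cell_subset by blast
  ultimately have "infnorm (x - cell_center \<sigma>) < 1 / (2 * 3 ^ k)"
    by (intro tube_in_cell assms(1))
  then show False
    using assms(2,3) rel_interior_grid_cell[OF cells_grid[OF assms(1)]] by blast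
qed

lemma cell_map:
  assumes "\<sigma> \<in> cells" "x \<in> \<sigma>"
  shows "cell_map \<sigma> x \<in> \<sigma>"
    and "tube_coord \<sigma> x < 1 \<Longrightarrow> cell_map \<sigma> x \<in> rel_interior \<sigma>"
    and "tube_coord \<sigma> x = 1 \<Longrightarrow> cell_map \<sigma> x \<in> \<sigma> - rel_interior \<sigma>"
    and "x \<notin> rel_interior \<sigma> \<Longrightarrow> cell_map \<sigma> x = x"
proof -
  note r = radial_grid_cell[OF cells_grid[OF assms(1)], where x = x and \<mu> = "tube_coord \<sigma>",
      OF assms(2) tube_coord_nonneg tube_coord_le_1, folded cell_map_def]
  show "cell_map \<sigma> x \<in> \<sigma>"
    by (rule r(1))
  show "cell_map \<sigma> x \<in> rel_interior \<sigma>" if "tube_coord \<sigma> x < 1"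
    by (rule r(2)[OF that])
  show "cell_map \<sigma> x \<in> \<sigma> - rel_interior \<sigma>" if "tube_coord \<sigma> x = 1"
  proof -
    have "x \<noteq> cell_center \<sigma>"
    proof
      assume "x = cell_center \<sigma>"
      then show False using tube_coord_center[OF assms(1)] that by simp
    qed
    then show ?thesis using r(1) r(3)[OF that] by blast
  qed
  show "cell_map \<sigma> x = x" if "x \<notin> rel_interior \<sigma>"
    by (rule r(4)[OF tube_coord_boundary[OF assms that] that])
qed

section \<open>Gluing the cell maps\<close>

lemma cells_overlap:
  assumes "\<sigma> \<in> cells" "\<tau> \<in> cells" "\<sigma> \<noteq> \<tau>" "x \<in> \<sigma>" "x \<in> \<tau>"
  shows "x \<notin> rel_interior \<tau>"
proof
  assume "x \<in> rel_interior \<tau>"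
  then have "infnorm (x - cell_center \<tau>) < 1 / (2 * 3 ^ k)"
    using rel_interior_grid_cell[OF cells_grid[OF assms(2)]] by blast
  then show False
    using grid_cell_eqI[OF cells_grid[OF assms(1)] cells_grid[OF assms(2)] assms(4)] assms(3) by blast
qed

lemma complex_map_eq:
  assumes \<sigma>: "\<sigma> \<in> cells" "x \<in> \<sigma>"
  shows "complex_map x = cell_map \<sigma> x"
proof -
  define \<tau> where "\<tau> = (SOME \<sigma>. \<sigma> \<in> cells \<and> x \<in> \<sigma>)"
  have "\<tau> \<in> cells \<and> x \<in> \<tau>"
    unfolding \<tau>_def by (rule someI[of _ \<sigma>]) (use \<sigma> in blast)
  then have \<tau>: "\<tau> \<in> cells" "x \<in> \<tau>" by blast+
  have "cell_map \<tau> x = cell_map \<sigma> x"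
  proof (cases "\<sigma> = \<tau>")
    case False
    then show ?thesis
      using cells_overlap[OF \<sigma>(1) \<tau>(1)] cells_overlap[OF \<tau>(1) \<sigma>(1)] cell_map(4)[OF \<sigma>] cell_map(4)[OF \<tau>]
        \<sigma>(2) \<tau>(2) by metis
  qed simp
  then show ?thesis by (simp add: complex_map_def \<tau>_def)
qed

text \<open>The coordinate has Lipschitz constant \<open>L * 3 ^ k / \<epsilon>\<close>, and the
  radius of the cell contributes \<open>1 / (2 * 3 ^ k)\<close>. The product no longer depends on
  \<open>k\<close>.\<close>

lemma cell_map_lipschitz:
  assumes \<sigma>: "\<sigma> \<in> cells" "x \<in> \<sigma>" "y \<in> \<sigma>"
  shows "norm (cell_map \<sigma> x - cell_map \<sigma> y) \<le>
    (L * (sqrt CARD('m) * (sqrt CARD('m) + 2)) / (2 * \<epsilon>)) * norm (x - y)"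
proof -
  let ?P = "L / (\<epsilon> * (1 / 3 ^ k))"
  have lip: "\<bar>tube_coord \<sigma> x - tube_coord \<sigma> y\<bar> \<le> ?P * norm (x - y)" if "x \<in> \<sigma>" "y \<in> \<sigma>" for x y
  proof -
    have xy: "x \<in> \<Union>K" "y \<in> \<Union>K" "cell_center \<sigma> \<in> \<Union>K"
      using that cell_subset[OF \<sigma>(1)] center_mem[OF \<sigma>(1)] by blast+
    obtain p where p: "F1 x = orbit G act p" using F1_eq_orbit[OF xy(1)] by blast
    obtain q where q: "F1 y = orbit G act q" using F1_eq_orbit[OF xy(2)] by blast
    obtain r where r: "F1 (cell_center \<sigma>) = orbit G act r" using F1_eq_orbit[OF xy(3)] by blast
    let ?d = "\<lambda>x. setdist (F1 x) (F1 (cell_center \<sigma>))" and ?e = "\<epsilon> * (1 / 3 ^ k)"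
    \<comment> \<open>Cutting off at 1 does not increase differences.\<close>
    have "\<bar>tube_coord \<sigma> x - tube_coord \<sigma> y\<bar> \<le> \<bar>?d x / ?e - ?d y / ?e\<bar>"
      unfolding tube_coord_def by linarith
    also have "\<dots> = \<bar>?d x - ?d y\<bar> / ?e"
      using tube_radius_pos by (simp only: diff_divide_distrib[symmetric] abs_divide abs_of_pos)
    also have "\<dots> \<le> L * norm (x - y) / ?e"
      using setdist_orbit_diff_le[of p r q] F1_lipschitz[OF xy(1,2)] tube_radius_pos
      unfolding p q r by (intro divide_right_mono) auto
    finally show ?thesis by (simp only: times_divide_eq_left)
  qed
  have "norm (cell_map \<sigma> x - cell_map \<sigma> y) \<le>
      1 / (2 * 3 ^ k) * ?P * (sqrt DIM(real ^ 'm) * (sqrt DIM(real ^ 'm) + 2)) * norm (x - y)"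
    unfolding cell_map_def
    using tube_coord_nonneg tube_coord_center[OF \<sigma>(1)] center_mem[OF \<sigma>(1)] \<sigma> L \<epsilon>
    by (intro radial_lipschitz[where S = \<sigma>] lip) auto
  also have "1 / (2 * 3 ^ k) * ?P = L / (2 * \<epsilon>)"
    using \<epsilon> by simp
  finally show ?thesis by simp
qed

text \<open>If \<open>M\<close> is the constant on cells, gluing yields
  \<open>2 * M + 2 * sqrt CARD('m) + 1\<close>. The first term is proportional to
  \<open>1 / \<epsilon>\<close>, and the others are absorbed through
  \<open>1 \<le> 1 / (2 * L * \<epsilon>)\<close>.\<close>

definition lipschitz_bound :: real where
  "lipschitz_bound = L * (sqrt CARD('m) * (sqrt CARD('m) + 2)) + (2 * sqrt CARD('m) + 1) / (2 * L)"

lemma complex_map_lipschitz: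
  assumes "x \<in> \<Union>K" "y \<in> \<Union>K"
  shows "norm (complex_map x - complex_map y) \<le> lipschitz_bound / \<epsilon> * norm (x - y)"
proof -
  let ?D = "sqrt CARD('m)"
  let ?M = "L * (?D * (?D + 2)) / (2 * \<epsilon>)"
  have "norm (complex_map x - complex_map y) \<le> (2 * ?M + 2 * ?D + 1) * norm (x - y)"
  proof (rule lipschitz_on_Union_grid_cells[of cells k l])
    show "cells \<subseteq> grid_cells k l" using cells_grid by blast
    show "norm (complex_map x - complex_map y) \<le> ?M * norm (x - y)" if "\<sigma> \<in> cells" "x \<in> \<sigma>" "y \<in> \<sigma>" for \<sigma> x y
      using cell_map_lipschitz[OF that] complex_map_eq that by simp
    show "complex_map x \<in> \<sigma>" if "\<sigma> \<in> cells" "x \<in> \<sigma>" for \<sigma> x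
      using cell_map(1)[OF that] complex_map_eq[OF that] by simp
  qed (use assms Union_cells L \<epsilon> in auto)
  also have "2 * ?M + 2 * ?D + 1 \<le> lipschitz_bound / \<epsilon>"
  proof -
    have "1 \<le> 1 / (2 * L) / \<epsilon>"
      using \<epsilon> by (simp only: pos_le_divide_eq mult_1)
    then have "(2 * ?D + 1) * 1 \<le> (2 * ?D + 1) * (1 / (2 * L) / \<epsilon>)"
      by (intro mult_left_mono) auto
    then show ?thesis using \<epsilon> by (simp add: lipschitz_bound_def add_divide_distrib)
  qed
  then have "(2 * ?M + 2 * ?D + 1) * norm (x - y) \<le> lipschitz_bound / \<epsilon> * norm (x - y)"
    by (intro mult_right_mono) auto
  finally show ?thesis .
qed

section \<open>The homotopy on the complex and its lift\<close>

definition complex_homotopy :: "real \<Rightarrow> real ^ 'm \<Rightarrow> real ^ 'm" where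
  "complex_homotopy t x = (1 - t) *\<^sub>R x + t *\<^sub>R complex_map x"

lemma complex_homotopy_boundary:
  assumes "\<sigma> \<in> cells" "x \<in> \<sigma>" "x \<notin> rel_interior \<sigma>"
  shows "complex_homotopy t x = x"
  using complex_map_eq[OF assms(1,2)] cell_map(4)[OF assms]
  by (simp add: complex_homotopy_def algebra_simps)

lemma complex_homotopy_mem:
  assumes "\<sigma> \<in> cells" "x \<in> \<sigma>" "t \<in> {0..1}"
  shows "complex_homotopy t x \<in> \<sigma>"
proof -
  obtain a J where "\<sigma> = grid_cell k a J"
    using cells_grid[OF assms(1)] unfolding grid_cells_iff by blast
  then have "convex \<sigma>" by (simp add: grid_cell_def)
  moreover have "complex_map x \<in> \<sigma>"
    using cell_map(1)[OF assms(1,2)] complex_map_eq[OF assms(1,2)] by simp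
  ultimately show ?thesis
    using assms(2,3) unfolding convex_alt complex_homotopy_def by auto
qed

lemma continuous_complex_map: "continuous_on (\<Union>K) complex_map"
proof -
  have "(lipschitz_bound / \<epsilon>)-lipschitz_on (\<Union>K) complex_map"
    using complex_map_lipschitz L \<epsilon> by (intro lipschitz_onI) (auto simp: dist_norm lipschitz_bound_def)
  then show ?thesis by (rule lipschitz_on_continuous_on)
qed

sublocale lift: equivariant_lift G act T cells cell_section complex_homotopy
proof
  show "compact_space T" "topspace T = carrier G"
    "continuous_map (prod_topology T euclidean) euclidean (\<lambda>(x, p). act x p)"
    by (rule compact_T topspace_T continuous_act)+
  show "finite cells"
    using finite_grid_cells by (rule finite_subset[rotated]) (auto simp: subdiv_cells_def)
  fix \<sigma> assume \<sigma>: "\<sigma> \<in> cells"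
  obtain a J where "\<sigma> = grid_cell k a J"
    using cells_grid[OF \<sigma>] unfolding grid_cells_iff by blast
  then show "compact \<sigma>" by (simp add: grid_cell_def)
  show "continuous_on \<sigma> (cell_section \<sigma>)" by (rule cell_section(1)[OF \<sigma>])
  have "continuous_on ({0..1} \<times> \<sigma>) (\<lambda>z. complex_map (snd z))"
    by (rule continuous_on_compose2[OF continuous_complex_map continuous_on_snd[OF continuous_on_id]])
      (use cell_subset[OF \<sigma>] in auto)
  then show "continuous_on ({0..1} \<times> \<sigma>) (\<lambda>(t, x). complex_homotopy t x)"
    unfolding complex_homotopy_def case_prod_beta by (intro continuous_intros)
  show "complex_homotopy t x \<in> \<sigma>" if "x \<in> \<sigma>" "t \<in> {0..1}" for x t
    by (rule complex_homotopy_mem[OF \<sigma> that])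
  show "stabilizer G act (cell_section \<sigma> x) \<subseteq> stabilizer G act (cell_section \<sigma> (complex_homotopy t x))"
    if "x \<in> \<sigma>" "t \<in> {0..1}" for x t
  \<comment> \<open>Inside the cell the isotropy group at \<open>x\<close> is contained in all
    others along the section; on the boundary the homotopy stands still.\<close>
  proof (cases "x \<in> rel_interior \<sigma>")
    case True
    then show ?thesis by (rule stabilizer_cell_section[OF \<sigma> _ complex_homotopy_mem[OF \<sigma> that]])
  next
    case False
    then show ?thesis using complex_homotopy_boundary[OF \<sigma> that(1)] by simp
  qed
  fix \<tau> assume \<tau>: "\<tau> \<in> cells"
  show "x = y" if "x \<in> \<sigma>" "y \<in> \<tau>" "orbit G act (cell_section \<sigma> x) = orbit G act (cell_section \<tau> y)" for x y
  proof (rule F1_inj)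
    show "x \<in> \<Union>K" "y \<in> \<Union>K" using that \<sigma> \<tau> cell_subset by blast+
    show "F1 x = F1 y" using that(3) cell_section(2)[OF \<sigma> that(1)] cell_section(2)[OF \<tau> that(2)] by simp
  qed
  show "complex_homotopy t x = x" if "\<sigma> \<noteq> \<tau>" "x \<in> \<sigma>" "x \<in> \<tau>" for x t
    by (rule complex_homotopy_boundary[OF \<tau> that(3) cells_overlap[OF \<sigma> \<tau> that]])
next
  fix p
  obtain \<sigma> x where \<sigma>: "\<sigma> \<in> cells" "x \<in> \<sigma>" "orbit G act p = F1 x"
    using orbit_eq_F1 by blast
  then have "orbit G act p = orbit G act (cell_section \<sigma> x)"
    using cell_section(2) by simp
  then show "\<exists>\<sigma>\<in>cells. \<exists>x\<in>\<sigma>. \<exists>g\<in>carrier G. p = act g (cell_section \<sigma> x)"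
    using \<sigma>(1,2) unfolding orbit_eq_iff by blast
qed

definition tube_expansion :: "'a \<Rightarrow> 'a" where
  "tube_expansion = lift.lifted 1"

text \<open>The lift covers the radial map, so the position of its values relative to the skeleton
  and the open cells can be read off in the complex.\<close>

lemma orbit_tube_expansion:
  assumes "\<sigma> \<in> cells" "x \<in> \<sigma>" "orbit G act p = F1 x"
  shows "orbit G act (tube_expansion p) = F1 (cell_map \<sigma> x)"
proof -
  have x: "complex_homotopy 1 x = cell_map \<sigma> x"
    using complex_map_eq[OF assms(1,2)] by (simp add: complex_homotopy_def)
  have "orbit G act p = orbit G act (cell_section \<sigma> x)"
    using assms cell_section(2) by simp
  then have "orbit G act (tube_expansion p) = orbit G act (cell_section \<sigma> (cell_map \<sigma> x))"
    unfolding tube_expansion_def using lift.orbit_lifted[OF assms(1,2)] x by simp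
  then show ?thesis
    using cell_section(2)[OF assms(1) cell_map(1)[OF assms(1,2)]] by simp
qed

section \<open>Images of the tubes and of their complement\<close>

abbreviation skeleton :: "'a set" where
  "skeleton \<equiv> lift G act F1 (\<Union>(subdiv_cells K k (l - 1)))"

abbreviation tubes :: "'a set" where
  "tubes \<equiv> open_tubes (\<epsilon> * (1 / 3 ^ k)) (center_orbits F1 K l k)"

lemma mem_skeleton: "p \<in> skeleton \<longleftrightarrow> (\<exists>\<sigma>\<in>cells. \<exists>x\<in>\<sigma> - rel_interior \<sigma>. orbit G act p = F1 x)"
  unfolding mem_lift Union_subdiv_faces[OF cubical l] by blast

text \<open>Injectivity of \<open>F1\<close> lets the difference of a cell and its relative interior
  pass through \<open>lift\<close>.\<close>

lemma skeleton_eq: "skeleton = (\<Union>\<sigma>\<in>cells. lift G act F1 \<sigma> - lift G act F1 (rel_interior \<sigma>))"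
proof (intro Set.set_eqI iffI)
  fix p assume "p \<in> skeleton"
  then obtain \<sigma> x where \<sigma>: "\<sigma> \<in> cells" "x \<in> \<sigma>" "x \<notin> rel_interior \<sigma>" "orbit G act p = F1 x"
    unfolding mem_skeleton by blast
  have "p \<notin> lift G act F1 (rel_interior \<sigma>)"
  proof
    assume "p \<in> lift G act F1 (rel_interior \<sigma>)"
    then obtain y where y: "y \<in> rel_interior \<sigma>" "orbit G act p = F1 y" unfolding mem_lift by blast
    then have "x \<in> \<Union>K" "y \<in> \<Union>K"
      using \<sigma>(1,2) cell_subset rel_interior_subset by blast+
    then have "x = y" using F1_inj \<sigma>(4) y(2) by simp
    then show False using \<sigma>(3) y(1) by simp
  qed
  moreover have "p \<in> lift G act F1 \<sigma>"
    unfolding mem_lift using \<sigma>(2,4) by blast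
  ultimately show "p \<in> (\<Union>\<sigma>\<in>cells. lift G act F1 \<sigma> - lift G act F1 (rel_interior \<sigma>))"
    using \<sigma>(1) by blast
next
  fix p assume "p \<in> (\<Union>\<sigma>\<in>cells. lift G act F1 \<sigma> - lift G act F1 (rel_interior \<sigma>))"
  then obtain \<sigma> where \<sigma>: "\<sigma> \<in> cells" "p \<in> lift G act F1 \<sigma>" "p \<notin> lift G act F1 (rel_interior \<sigma>)"
    by blast
  obtain x where x: "x \<in> \<sigma>" "orbit G act p = F1 x"
    using \<sigma>(2) unfolding mem_lift by blast
  have "x \<in> \<sigma> - rel_interior \<sigma>"
    using x \<sigma>(3) unfolding mem_lift by blast
  then show "p \<in> skeleton"
    unfolding mem_skeleton using \<sigma>(1) x(2) by (intro bexI)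
qed

lemma equivariant_tube_expansion: "equivariant G act tube_expansion"
  unfolding tube_expansion_def by (rule lift.equivariant_lifted) simp

lemma homotopic_tube_expansion:
  "homotopic_with_canon (\<lambda>h. equivariant G act h \<and> (\<forall>p\<in>skeleton. h p = p)) UNIV UNIV id tube_expansion"
  unfolding tube_expansion_def
proof (rule lift.homotopic_lifted)
  show "complex_homotopy 0 x = x" for x
    by (simp add: complex_homotopy_def)
  fix p and t :: real assume "p \<in> skeleton" and t: "t \<in> {0..1}"
  then obtain \<sigma> x where \<sigma>: "\<sigma> \<in> cells" "x \<in> \<sigma>" "x \<notin> rel_interior \<sigma>" "orbit G act p = F1 x"
    unfolding mem_skeleton by blast
  then have "orbit G act p = orbit G act (cell_section \<sigma> x)"
    using cell_section(2) by simp
  then show "lift.lifted t p = p"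
    using \<sigma> t complex_homotopy_boundary by (intro lift.lifted_eq_self) auto
qed

lemma continuous_tube_expansion: "continuous_on UNIV tube_expansion"
  using homotopic_with_imp_continuous_maps[OF homotopic_tube_expansion] by simp

lemma mem_tubes: "p \<in> tubes \<longleftrightarrow> (\<exists>\<sigma>\<in>cells. infdist p (F1 (cell_center \<sigma>)) < \<epsilon> * (1 / 3 ^ k))"
  by (auto simp: open_tubes_def center_orbits_def)

lemma tube_coord_less_1_iff_infdist:
  assumes "\<sigma> \<in> cells" "x \<in> \<Union>K" "orbit G act p = F1 x"
  shows "tube_coord \<sigma> x < 1 \<longleftrightarrow> infdist p (F1 (cell_center \<sigma>)) < \<epsilon> * (1 / 3 ^ k)"
proof -
  have "cell_center \<sigma> \<in> \<Union>K" using center_mem cell_subset assms(1) by blast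
  then show ?thesis using setdist_F1[OF assms(2) _ assms(3)] by (simp only: tube_coord_less_1_iff)
qed

text \<open>Outside all tubes the coordinate has reached its cut-off 1 in whichever cell contains
  the point, so the radial map ends on the boundary.\<close>

lemma tube_expansion_outside_tubes: "tube_expansion ` (UNIV - tubes) \<subseteq> skeleton"
proof
  fix q assume "q \<in> tube_expansion ` (UNIV - tubes)"
  then obtain p where p: "p \<notin> tubes" "q = tube_expansion p" by blast
  obtain \<sigma> x where \<sigma>: "\<sigma> \<in> cells" "x \<in> \<sigma>" "orbit G act p = F1 x"
    using orbit_eq_F1 by blast
  have "x \<in> \<Union>K" using \<sigma>(1,2) cell_subset by blast
  then have "\<not> tube_coord \<sigma> x < 1"
    using p(1) \<sigma> unfolding mem_tubes by (auto simp: tube_coord_less_1_iff_infdist)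
  then have "tube_coord \<sigma> x = 1" using tube_coord_le_1[of \<sigma> x] by linarith
  then have "cell_map \<sigma> x \<in> \<sigma> - rel_interior \<sigma>" by (rule cell_map(3)[OF \<sigma>(1,2)])
  then show "q \<in> skeleton"
    unfolding mem_skeleton p(2) using orbit_tube_expansion[OF \<sigma>] \<sigma>(1) by blast
qed

lemma tube_expansion_tubes: "tube_expansion ` tubes \<subseteq> (\<Union>\<sigma>\<in>cells. lift G act F1 (rel_interior \<sigma>))"
proof
  fix q assume "q \<in> tube_expansion ` tubes"
  then obtain p where p: "p \<in> tubes" "q = tube_expansion p" by blast
  then obtain \<sigma> where \<sigma>: "\<sigma> \<in> cells" "infdist p (F1 (cell_center \<sigma>)) < \<epsilon> * (1 / 3 ^ k)"
    unfolding mem_tubes by blast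
  obtain \<tau> x where \<tau>: "\<tau> \<in> cells" "x \<in> \<tau>" "orbit G act p = F1 x"
    using orbit_eq_F1 by blast
  have "x \<in> \<Union>K" using \<tau>(1,2) cell_subset by blast
  then have lt: "tube_coord \<sigma> x < 1"
    using \<sigma> \<tau>(3) tube_coord_less_1_iff_infdist by blast
  \<comment> \<open>The tube of \<sigma> is confined to \<sigma>, so the cell containing
    \<open>x\<close> can only be the one whose tube contains \<open>p\<close>.\<close>
  then have "\<tau> = \<sigma>"
    using tube_in_cell[OF \<sigma>(1) \<open>x \<in> \<Union>K\<close>] grid_cell_eqI[OF cells_grid[OF \<tau>(1)] cells_grid[OF \<sigma>(1)] \<tau>(2)]
    by blast
  then have "cell_map \<sigma> x \<in> rel_interior \<sigma>" "orbit G act q = F1 (cell_map \<sigma> x)"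
    using cell_map(2)[OF \<tau>(1,2)] lt orbit_tube_expansion[OF \<tau>] p(2) by simp_all
  then show "q \<in> (\<Union>\<sigma>\<in>cells. lift G act F1 (rel_interior \<sigma>))"
    using \<sigma>(1) unfolding UN_iff mem_lift by blast
qed

section \<open>Lipschitz bounds on the orbit space\<close>

lemma induced_map_tube_expansion:
  assumes "x \<in> \<Union>K"
  shows "induced_map tube_expansion (F1 x) = F1 (complex_map x)" "complex_map x \<in> \<Union>K"
proof -
  obtain \<sigma> where \<sigma>: "\<sigma> \<in> cells" "x \<in> \<sigma>" using assms unfolding Union_cells[symmetric] by blast
  obtain p where p: "F1 x = orbit G act p" using F1_eq_orbit[OF assms] by blast
  have "tube_expansion ` orbit G act p = orbit G act (tube_expansion p)"
    using equivariant_tube_expansion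
    by (simp add: orbit_def equivariant_def setcompr_eq_image image_image)
  then show "induced_map tube_expansion (F1 x) = F1 (complex_map x)"
    using orbit_tube_expansion[OF \<sigma> p[symmetric]] complex_map_eq[OF \<sigma>] p by (simp add: induced_map_def)
  show "complex_map x \<in> \<Union>K"
    using cell_map(1)[OF \<sigma>] complex_map_eq[OF \<sigma>] cell_subset[OF \<sigma>(1)] by auto
qed

text \<open>Passing from the orbit space to the complex and back through \<open>F1\<close> costs a
  factor \<open>L\<close> each time.\<close>

lemma induced_tube_expansion_lipschitz:
  assumes "P \<in> orbits G UNIV act" "Q \<in> orbits G UNIV act"
  shows "setdist (induced_map tube_expansion P) (induced_map tube_expansion Q) \<le>
    L\<^sup>2 * lipschitz_bound * inverse \<epsilon> * setdist P Q"
proof -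
  have "P \<in> F1 ` \<Union>K" "Q \<in> F1 ` \<Union>K"
    unfolding bij_betw_imp_surj_on[OF F1_bij] by (fact assms)+
  then obtain x y where x: "x \<in> \<Union>K" "P = F1 x" and y: "y \<in> \<Union>K" "Q = F1 y"
    by (elim imageE)
  have C: "0 \<le> lipschitz_bound / \<epsilon>" using L \<epsilon> by (simp add: lipschitz_bound_def)
  have "setdist (induced_map tube_expansion P) (induced_map tube_expansion Q) \<le> L * norm (complex_map x - complex_map y)"
    using F1_lipschitz induced_map_tube_expansion x y by simp
  also have "\<dots> \<le> L * (lipschitz_bound / \<epsilon> * norm (x - y))"
    using complex_map_lipschitz[OF x(1) y(1)] L by (intro mult_left_mono) auto
  also have "\<dots> \<le> L * (lipschitz_bound / \<epsilon> * (L * setdist P Q))"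
    using F1_expanding[OF x(1) y(1)] L C x y by (intro mult_left_mono) auto
  finally show ?thesis by (simp add: divide_inverse power2_eq_square ac_simps)
qed

lemma induced_tube_expansion_local_lipschitz:
  "local_lipschitz_const (orbits G UNIV act) setdist setdist (induced_map tube_expansion) Q
    \<le> ennreal (L\<^sup>2 * lipschitz_bound * inverse \<epsilon>)"
  unfolding local_lipschitz_const_def
\<comment> \<open>The bound holds globally, so any radius will do.\<close>
proof (rule INF_lower2[of 1])
  let ?C = "L\<^sup>2 * lipschitz_bound * inverse \<epsilon>"
  have "0 \<le> ?C" using L \<epsilon> by (simp add: lipschitz_bound_def)
  have "setdist (induced_map tube_expansion P) (induced_map tube_expansion R) / setdist P R \<le> ?C"
    if "P \<in> orbits G UNIV act" "R \<in> orbits G UNIV act" for P R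
  \<comment> \<open>Division by 0 gives 0, which settles the degenerate case.\<close>
  proof (cases "setdist P R = 0")
    case True
    then show ?thesis using \<open>0 \<le> ?C\<close> by simp
  next
    case False
    then have "0 < setdist P R" using setdist_pos_le[of P R] by linarith
    then show ?thesis using induced_tube_expansion_lipschitz[OF that] by (simp only: pos_divide_le_eq)
  qed
  then show "(SUP (y, z)\<in>{(y, z). y \<in> orbits G UNIV act \<and> z \<in> orbits G UNIV act \<and> y \<noteq> z \<and>
      setdist Q y < 1 \<and> setdist Q z < 1}.
      ennreal (setdist (induced_map tube_expansion y) (induced_map tube_expansion z) / setdist y z)) \<le> ennreal ?C"
    by (intro SUP_least) (auto intro!: ennreal_leI)
qed simp

end

theorem proposition8p3:
  fixes n l :: nat
    and A :: "('a::metric_space, real ^ 'n) chart set"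
    and g :: "('a, real ^ 'n) local_metric"
    and G :: "('g, 'x) monoid_scheme"
    and E :: "'e::euclidean_space set"
    and T :: "'g topology"
    and B :: "('g, 'e) chart set"
    and act :: "'g \<Rightarrow> 'a \<Rightarrow> 'a"
    and K :: "(real ^ 'm) set set"
    and F1 :: "real ^ 'm \<Rightarrow> 'a set"
  assumes "closed_connected_riemannian_manifold A g"
    and "orientable euclidean A"
    and "CARD('n) = n + 1"
    and "compact_lie_group G E T B"
    and "smooth_isometric_action G T B A g act"
    and "has_cohomogeneity A G act l"
    and "l \<ge> 3"
    and "adapted_cubical_structure G act l K F1"
  shows "\<exists>C1 \<epsilon>0. C1 > 0 \<and> \<epsilon>0 > 0 \<and>
    (\<forall>k. \<forall>\<epsilon>::real. 0 < \<epsilon> \<and> \<epsilon> \<le> \<epsilon>0 \<longrightarrow>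
      (let skeleton = lift G act F1 (\<Union>(subdiv_cells K k (l - 1)));
           tubes = open_tubes (\<epsilon> * (1 / 3 ^ k)) (center_orbits F1 K l k)
       in
         skeleton = (\<Union>\<sigma>\<in>subdiv_cells K k l. lift G act F1 \<sigma> - lift G act F1 (rel_interior \<sigma>)) \<and>
         (\<exists>F. equivariant G act F \<and> continuous_on UNIV F \<and>
            homotopic_with_canon (\<lambda>h. equivariant G act h \<and> (\<forall>p\<in>skeleton. h p = p))
              UNIV UNIV id F \<and>
            F ` (UNIV - tubes) \<subseteq> skeleton \<and>
            F ` tubes \<subseteq> (\<Union>\<sigma>\<in>subdiv_cells K k l. lift G act F1 (rel_interior \<sigma>)) \<and>
            lipschitz_map (orbits G UNIV act) setdist setdist (induced_map F) \<and>
            (\<forall>Q\<in>orbits G UNIV act.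
               local_lipschitz_const (orbits G UNIV act) setdist setdist (induced_map F) Q
                 \<le> ennreal (C1 * inverse \<epsilon>)))))"
proof -
  obtain L where "L > 0" and L: "\<And>x y. x \<in> \<Union>K \<Longrightarrow> y \<in> \<Union>K \<Longrightarrow>
      setdist (F1 x) (F1 y) \<le> L * dist x y \<and> dist x y \<le> L * setdist (F1 x) (F1 y)"
    using assms(8) unfolding adapted_cubical_structure_def bilipschitz_homeo_def by blast
  \<comment> \<open>This is \<open>L\<^sup>2 * lipschitz_bound\<close> written out, since it has to
    be chosen before the locale fixes \<open>k\<close> and \<epsilon>.\<close>
  define C where "C = L\<^sup>2 * (L * (sqrt CARD('m) * (sqrt CARD('m) + 2)) + (2 * sqrt CARD('m) + 1) / (2 * L))"
  have "0 < L * (sqrt CARD('m) * (sqrt CARD('m) + 2))" "0 < (2 * sqrt CARD('m) + 1) / (2 * L)"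
    using \<open>L > 0\<close> by (auto intro!: mult_pos_pos divide_pos_pos add_nonneg_pos)
  then have "C > 0"
    using \<open>L > 0\<close> unfolding C_def by (intro mult_pos_pos add_pos_pos) auto
  have space: "cubical_orbit_space G act T l K F1 L \<epsilon>"
    if "0 < \<epsilon>" "\<epsilon> \<le> 1 / (2 * L)" for \<epsilon> :: real
  proof (intro cubical_orbit_space.intro isometric_action.intro isometric_action_axioms.intro
      cubical_orbit_space_axioms.intro)
    show "group_action G UNIV act"
      using assms(5) by (simp add: smooth_isometric_action_def)
    show "dist (act x p) (act x q) = dist p q" if "x \<in> carrier G" for x p q
      by (rule smooth_isometric_action_dist[OF assms(1,4,5) that])
    show "compact (UNIV :: 'a set)"
      using assms(1) by (simp add: closed_connected_riemannian_manifold_def)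
    show "compact_space T" "topspace T = carrier G"
      using assms(4) by (simp_all add: compact_lie_group_def)
    show "continuous_map (prod_topology T euclidean) euclidean (\<lambda>(x, p). act x p)"
      using assms(5) by (simp add: smooth_isometric_action_def smooth_map_def)
    show "setdist (F1 x) (F1 y) \<le> L * norm (x - y)" "norm (x - y) \<le> L * setdist (F1 x) (F1 y)"
      if "x \<in> \<Union>K" "y \<in> \<Union>K" for x y
      using L[OF that] by (simp_all add: dist_norm)
  qed (use assms(7,8) \<open>L > 0\<close> that in auto)
  show ?thesis
  \<comment> \<open>The threshold \<open>1 / (2 * L)\<close> is the bound under which
    \<open>tube_in_cell\<close> confines every tube to its cell.\<close>
  proof (rule exI[of _ C], rule exI[of _ "1 / (2 * L)"], intro conjI allI impI)
    fix k :: nat and \<epsilon> :: real assume \<epsilon>: "0 < \<epsilon> \<and> \<epsilon> \<le> 1 / (2 * L)"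
    interpret cubical_orbit_space G act T l K F1 L k \<epsilon>
      by (rule space) (use \<epsilon> in auto)
    have C: "C = L\<^sup>2 * lipschitz_bound"
      by (simp add: C_def lipschitz_bound_def)
    have lip: "lipschitz_map (orbits G UNIV act) setdist setdist (induced_map tube_expansion)"
      unfolding lipschitz_map_def using induced_tube_expansion_lipschitz by blast
    show "let skeleton = lift G act F1 (\<Union>(subdiv_cells K k (l - 1)));
           tubes = open_tubes (\<epsilon> * (1 / 3 ^ k)) (center_orbits F1 K l k)
       in
         skeleton = (\<Union>\<sigma>\<in>subdiv_cells K k l. lift G act F1 \<sigma> - lift G act F1 (rel_interior \<sigma>)) \<and>
         (\<exists>F. equivariant G act F \<and> continuous_on UNIV F \<and>
            homotopic_with_canon (\<lambda>h. equivariant G act h \<and> (\<forall>p\<in>skeleton. h p = p))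
              UNIV UNIV id F \<and>
            F ` (UNIV - tubes) \<subseteq> skeleton \<and>
            F ` tubes \<subseteq> (\<Union>\<sigma>\<in>subdiv_cells K k l. lift G act F1 (rel_interior \<sigma>)) \<and>
            lipschitz_map (orbits G UNIV act) setdist setdist (induced_map F) \<and>
            (\<forall>Q\<in>orbits G UNIV act.
               local_lipschitz_const (orbits G UNIV act) setdist setdist (induced_map F) Q
                 \<le> ennreal (C * inverse \<epsilon>)))"
      unfolding Let_def C
      using skeleton_eq equivariant_tube_expansion continuous_tube_expansion homotopic_tube_expansion
        tube_expansion_outside_tubes tube_expansion_tubes lip induced_tube_expansion_local_lipschitz
      by (intro conjI exI[of _ tube_expansion] ballI)
  qed (use \<open>C > 0\<close> \<open>L > 0\<close> in auto)
qed

end
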